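(* Let $q$ be an odd prime power. Then $$B_q(n)=\frac{K_q}{\sqrt{\pi}}\cdot\frac{q^n}{\sqrt{n}}+O_q\Big(\frac{q^n}{n^{3/2}}\Big),\qquad n\to\infty,$$ where $$K_q=\left(1-q^{-1}\right)^{-\frac12}\prod_{P:\ \left(\frac{P}{T}\right)=-1}\left(1-|P|^{-2}\right)^{-\frac12},$$ the product running over all primes $P\in\mathbb{F}_q[T]$ with $\left(\frac{P}{T}\right)=-1$. The implied constant depends only on $q$.
   Context: Let $\mathcal{M}_{n,q}$ be the set of monic polynomials of degree $n$ in $\mathbb{F}_q[T]$. For $f\in\mathcal{M}_{n,q}$ put $b_q(f)=1$ if $f=A^2+TB^2$ for some $A,B\in\mathbb{F}_q[T]$, and $b_q(f)=0$ otherwise. Define $B_q(n)=\sum_{f\in\mathcal{M}_{n,q}} b_q(f)$. A prime of $\mathbb{F}_q[T]$ is a monic irreducible polynomial, and $|P|=q^{\deg P}$. The Legendre symbol modulo a prime $P$ is $\left(\frac{f}{P}\right)\equiv f^{(|P|-1)/2} \pmod P$, taken in $\{0,1,-1\}$; in particular $\left(\frac{f}{T}\right)$ is $1$, $-1$ or $0$ according as $f(0)\in\mathbb{F}_q$ is a nonzero square, a non-square, or zero. *)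

theory Defs
  imports
    "HOL-Analysis.Analysis"
    "HOL-Library.Landau_Symbols"
    "HOL-Number_Theory.Cong"
begin

text \<open>
  The field with \<open>q\<close> elements is a type \<open>'a :: {field, finite}\<close> with \<open>CARD('a) = q\<close>, and
  its polynomial ring is \<open>'a poly\<close>. Constants whose value depends on the field only take an
  argument of type \<open>'a itself\<close>.
\<close>

abbreviation indet :: "'a :: comm_semiring_1 poly"
  where "indet \<equiv> [:0, 1:]"

definition monic_polys :: "nat \<Rightarrow> 'a :: {field, finite} poly set"
  where "monic_polys n = {f. lead_coeff f = 1 \<and> degree f = n}"

definition monic_primes :: "'a :: {field, finite} poly set"
  where "monic_primes = {P. lead_coeff P = 1 \<and> irreducible P}"

definition pnorm :: "'a :: {field, finite} poly \<Rightarrow> nat"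
  where "pnorm f = CARD('a) ^ degree f"

text \<open>
  The value is unique, and hence the definite description meaningful, when \<open>P\<close> is a prime and
  \<open>CARD('a)\<close> is odd.
\<close>
definition legendre :: "'a :: {field, finite} poly \<Rightarrow> 'a poly \<Rightarrow> int"
  where "legendre f P =
    (THE s. s \<in> {0, 1, -1} \<and> [f ^ ((pnorm P - 1) div 2) = of_int s] (mod P))"

definition bq :: "'a :: {field, finite} poly \<Rightarrow> nat"
  where "bq f = (if \<exists>A B. f = A\<^sup>2 + indet * B\<^sup>2 then 1 else 0)"

definition Bq :: "'a :: {field, finite} itself \<Rightarrow> nat \<Rightarrow> nat"
  where "Bq _ n = (\<Sum>f \<in> (monic_polys n :: 'a poly set). bq f)"

definition inert_primes :: "'a :: {field, finite} poly set"
  where "inert_primes = {P \<in> monic_primes. legendre P indet = -1}"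

definition euler_factor :: "'a :: {field, finite} poly \<Rightarrow> real"
  where "euler_factor P = (1 - 1 / real (pnorm P) ^ 2) powr (-1/2)"

text \<open>
  The product over the countable set of primes is unordered: the limit of its finite
  subproducts along the net of finite subsets, the multiplicative analogue of \<^const>\<open>infsum\<close>.
  All factors are at least 1, so a limit is automatically nonzero.
\<close>
definition euler_product_converges :: "'a :: {field, finite} itself \<Rightarrow> bool"
  where "euler_product_converges _ \<longleftrightarrow>
    (\<exists>L. ((\<lambda>S. \<Prod>P\<in>S. euler_factor P) \<longlongrightarrow> L)
           (finite_subsets_at_top (inert_primes :: 'a poly set)))"

definition Kq :: "'a :: {field, finite} itself \<Rightarrow> real"
  where "Kq _ = (1 - 1 / real CARD('a)) powr (-1/2) *
    Lim (finite_subsets_at_top (inert_primes :: 'a poly set)) (\<lambda>S. \<Prod>P\<in>S. euler_factor P)"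

end

theory Submission
  imports
    Defs
    "HOL-Computational_Algebra.Polynomial_Factorial"
    "HOL-Computational_Algebra.Formal_Laurent_Series"
    "HOL-Real_Asymp.Real_Asymp"
begin

text \<open>
  A monic \<open>f\<close> has the form \<open>A\<^sup>2 + T B\<^sup>2\<close> iff every inert prime divides it to an even power. For a prime
  that is not inert, reciprocity and Euler's criterion make \<open>-T\<close> a square modulo \<open>P\<close>, and Thue's
  pigeonhole argument turns this into a representation of \<open>P\<close>. Comparing Euler factors, the generating
  function \<open>D(u)\<close> of \<open>b\<^sub>q\<close> satisfies \<open>D\<^sup>2 = \<zeta> L G\<^sup>2\<close>, where \<open>\<zeta> = 1/(1 - qu)\<close>, where \<open>L = 1\<close> is the
  \<open>L\<close>-function of the quadratic character of \<open>f(0)\<close>, and where \<open>G\<close> is a product of inverse square roots whose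
  coefficients lie between \<open>0\<close> and \<open>(n + 1) q\<^bsup>n/2\<^esup>\<close>. Hence \<open>D = (1 - qu)\<^bsup>-1/2\<^esup> G\<close> as formal power series, so
  \<open>B\<^sub>q(n)/q\<^sup>n\<close> is the convolution of the coefficients of \<open>(1 - u)\<^bsup>-1/2\<^esup>\<close>, which are
  \<open>1/\<surd>(\<pi>n) + O(n\<^bsup>-3/2\<^esup>)\<close> by Wallis' product, with an exponentially decaying sequence of sum \<open>G(1/q) = K\<^sub>q\<close>.
\<close>

section \<open>Polynomials over a finite field\<close>

text \<open>Only the square of D is a product of L-series, so all Euler factors are compared after
  squaring; the root is extracted once, in the integral domain of real power series, where the
  constant terms settle the sign. That L is trivial is what makes the singular part a pure binomial
  series, so no complex analysis is needed. The prime T is ramified: L has no factor there, so G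
  must supply the missing square root, which is the origin of the isolated factor (1 - 1/q)^(-1/2)
  in K_q. Primes are never counted: the decay of the coefficients of G comes from its support alone.
  The facts required of the constant field F_q are the case P = T of Fermat's theorem and of Euler's
  criterion modulo P.\<close>

definition polys_below :: "nat \<Rightarrow> 'a :: {field, finite} poly set"
  where "polys_below n = {p. \<forall>i\<ge>n. coeff p i = 0}"

lemma polys_below_0: "polys_below 0 = {0}"
  by (auto simp: polys_below_def poly_eq_iff)

lemma polys_below_Suc: "polys_below (Suc n) = (\<lambda>(a, p). pCons a p) ` (UNIV \<times> polys_below n)"
proof (intro equalityI subsetI)
  fix p :: "'a poly" assume "p \<in> polys_below (Suc n)"
  then obtain a r where "p = pCons a r" "\<forall>i\<ge>Suc n. coeff (pCons a r) i = 0"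
    by (cases p) (auto simp: polys_below_def)
  then have "p = pCons a r" "r \<in> polys_below n"
    by (auto simp: polys_below_def dest: spec[of _ "Suc _"])
  then show "p \<in> (\<lambda>(a, p). pCons a p) ` (UNIV \<times> polys_below n)" by auto
qed (auto simp: polys_below_def coeff_pCons split: nat.splits)

lemma finite_card_polys_below:
  "finite (polys_below n :: 'a :: {field, finite} poly set) \<and>
   card (polys_below n :: 'a poly set) = CARD('a) ^ n"
proof (induction n)
  case 0
  then show ?case by (simp add: polys_below_0)
next
  case (Suc n)
  have "inj_on (\<lambda>(a, p). pCons a p) (UNIV \<times> polys_below n :: ('a \<times> 'a poly) set)"
    by (auto simp: inj_on_def)
  with Suc show ?case
    by (simp add: polys_below_Suc card_image card_cartesian_product)
qed

lemmas finite_polys_below [simp] = finite_card_polys_below[THEN conjunct1]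
lemmas card_polys_below = finite_card_polys_below[THEN conjunct2]

text \<open>A degree bound does not describe the set at n = 0, where it is {0} although no degree is
  below 0. Defining it by vanishing coefficients keeps it an additive group with q^n elements for
  every n.\<close>

lemma polys_below_iff_degree: "n > 0 \<Longrightarrow> p \<in> polys_below n \<longleftrightarrow> degree p < n"
  by (auto simp: polys_below_def coeff_eq_0 intro: degree_lessI)

lemma zero_in_polys_below [simp]: "0 \<in> polys_below n"
  by (simp add: polys_below_def)

lemma polys_below_diff: "p \<in> polys_below n \<Longrightarrow> r \<in> polys_below n \<Longrightarrow> p - r \<in> polys_below n"
  by (simp add: polys_below_def)

lemma polys_below_uminus: "p \<in> polys_below n \<Longrightarrow> - p \<in> polys_below n"
  by (simp add: polys_below_def)

lemma mod_in_polys_below: "degree P > 0 \<Longrightarrow> a mod P \<in> polys_below (degree P)"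
  using degree_mod_less[of P a] by (cases "P = 0") (auto simp: polys_below_iff_degree)

lemma polys_below_dvd_imp_0:
  assumes "P dvd r" "r \<in> polys_below (degree P)" shows "r = 0"
proof (rule ccontr)
  assume "r \<noteq> 0"
  with assms(1) have "degree P \<le> degree r" by (rule dvd_imp_degree_le)
  with assms(2) have "coeff r (degree r) = 0" by (simp add: polys_below_def)
  with \<open>r \<noteq> 0\<close> show False by simp
qed

lemma polys_below_cong_imp_eq:
  "P dvd r - s \<Longrightarrow> r \<in> polys_below (degree P) \<Longrightarrow> s \<in> polys_below (degree P) \<Longrightarrow> r = s"
  using polys_below_dvd_imp_0[of P "r - s"] by (simp add: polys_below_diff)

lemma monic_polys_eq_image:
  "(monic_polys n :: 'a :: {field, finite} poly set) = (+) (monom 1 n) ` polys_below n"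
proof (intro equalityI subsetI)
  fix f :: "'a poly" assume "f \<in> monic_polys n"
  then have "f - monom 1 n \<in> polys_below n"
    by (auto simp: monic_polys_def polys_below_def coeff_eq_0 le_less)
  then show "f \<in> (+) (monom 1 n) ` polys_below n"
    by (force intro: image_eqI[of _ _ "f - monom 1 n"])
next
  fix f :: "'a poly" assume "f \<in> (+) (monom 1 n) ` polys_below n"
  then obtain r where r: "f = monom 1 n + r" "r \<in> polys_below n" by auto
  have "degree f = n"
  proof (rule antisym)
    show "degree f \<le> n" using r
      by (intro degree_le) (auto simp: polys_below_def)
    show "n \<le> degree f" using r
      by (intro le_degree) (auto simp: polys_below_def)
  qed
  then show "f \<in> monic_polys n" using r by (auto simp: monic_polys_def polys_below_def)
qed

lemma finite_monic_polys [simp]: "finite (monic_polys n)"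
  by (simp add: monic_polys_eq_image)

lemma card_monic_polys: "card (monic_polys n :: 'a :: {field, finite} poly set) = CARD('a) ^ n"
  by (simp add: monic_polys_eq_image card_image card_polys_below)

section \<open>Monic primes and Fermat's theorem modulo a prime\<close>

lemma monic_prime_irreducible: "P \<in> monic_primes \<Longrightarrow> irreducible P"
  by (simp add: monic_primes_def)

lemma monic_prime_lead_coeff: "P \<in> monic_primes \<Longrightarrow> lead_coeff P = 1"
  by (simp add: monic_primes_def)

lemma monic_prime_prime_elem: "P \<in> monic_primes \<Longrightarrow> prime_elem P"
  by (simp add: monic_primes_def field_poly_irreducible_imp_prime)

lemma monic_prime_degree: "P \<in> monic_primes \<Longrightarrow> degree P > 0"
  by (metis irreducible_not_unit is_unit_iff_degree irreducible_def monic_prime_irreducible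
      bot_nat_0.not_eq_extremum)

lemma monic_prime_nonzero: "P \<in> monic_primes \<Longrightarrow> P \<noteq> 0"
  using monic_prime_degree by force

lemma monic_cofactor:
  fixes P g :: "'a :: field poly"
  assumes "lead_coeff P = 1" "lead_coeff (P * g) = 1"
  shows "lead_coeff g = 1"
  using assms lead_coeff_mult[of P g] by (simp only: mult_1)

lemma degree_monic_mult:
  fixes P g :: "'a :: field poly"
  assumes "lead_coeff P = 1" "lead_coeff g = 1"
  shows "degree (P * g) = degree P + degree g"
  using assms by (intro degree_mult_eq) auto

lemma monic_primes_dvd_imp_eq:
  assumes "P \<in> monic_primes" "Q \<in> monic_primes" "P dvd Q"
  shows "P = Q"
proof -
  obtain c where c: "Q = P * c" using assms(3) by blast
  have "\<not> is_unit P"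
    using assms(1) irreducible_not_unit monic_prime_irreducible by blast
  then have "is_unit c"
    using c assms(2) irreducibleD monic_prime_irreducible by blast
  then have "degree c = 0"
    using is_unit_iff_degree[of c] by (metis not_is_unit_0)
  moreover have "lead_coeff c = 1"
    using monic_cofactor[of P c] assms c monic_prime_lead_coeff by metis
  ultimately have "c = 1" by (metis degree_0_id one_pCons)
  with c show ?thesis by simp
qed

lemma monic_degree_0: "lead_coeff f = 1 \<Longrightarrow> degree f = 0 \<Longrightarrow> f = 1"
  by (metis degree_0_id one_pCons)

lemma exists_monic_prime_factor:
  fixes f :: "'a :: {field, finite} poly"
  assumes "degree f > 0"
  shows "\<exists>P\<in>monic_primes. P dvd f"
  using assms
proof (induction "degree f" arbitrary: f rule: less_induct)
  case less
  show ?case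
  proof (cases "irreducible f")
    case True
    let ?P = "smult (inverse (lead_coeff f)) f"
    from less have "f \<noteq> 0" by auto
    then have u: "is_unit [:inverse (lead_coeff f):]" by (simp add: is_unit_pCons_iff)
    have "irreducible ?P"
      using True u by (metis irreducible_mult_unit_left smult_conv_map_poly mult_pCons_left
          mult_zero_left pCons_0_0 add_0_right)
    then have "?P \<in> monic_primes" using \<open>f \<noteq> 0\<close> by (simp add: monic_primes_def)
    moreover have "?P dvd f" using \<open>f \<noteq> 0\<close> by (simp add: smult_dvd_iff)
    ultimately show ?thesis by blast
  next
    case False
    from less have "f \<noteq> 0" by auto
    with less have f0: "f \<noteq> 0" "\<not> is_unit f" by (auto simp: is_unit_iff_degree)
    with False obtain a b where ab: "f = a * b" "\<not> is_unit a" "\<not> is_unit b"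
      by (auto simp: irreducible_def)
    with f0 have "a \<noteq> 0" "b \<noteq> 0" by auto
    with ab have "degree a > 0" "degree b > 0" by (auto simp: is_unit_iff_degree)
    moreover have "degree f = degree a + degree b"
      using ab \<open>a \<noteq> 0\<close> \<open>b \<noteq> 0\<close> by (simp add: degree_mult_eq)
    ultimately obtain P where "P \<in> monic_primes" "P dvd a"
      using less(1)[of a] by auto
    with ab show ?thesis by (meson dvd_mult2)
  qed
qed

text \<open>Multiplication by \<open>a\<close> permutes the nonzero residues, represented by the
  nonzero polynomials of degree below that of P. Comparing the product of all residues before and
  after, that product can be cancelled.\<close>

lemma fermat_mod_prime:
  fixes P a :: "'a :: {field, finite} poly"
  assumes P: "P \<in> monic_primes" and a: "\<not> P dvd a"
  shows "P dvd a ^ (pnorm P - 1) - 1"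
proof -
  note pe = monic_prime_prime_elem[OF P]
  let ?R = "polys_below (degree P) - {0} :: 'a poly set"
  have dm: "P dvd x - x mod P" for x by (simp add: minus_mod_eq_mult_div)
  have ndvd: "\<not> P dvd r" if "r \<in> ?R" for r using that polys_below_dvd_imp_0 by auto
  have inj: "inj_on (\<lambda>r. (a * r) mod P) ?R"
  proof (rule inj_onI)
    fix r s assume rs: "r \<in> ?R" "s \<in> ?R" "(a * r) mod P = (a * s) mod P"
    then have "P dvd a * (r - s)" by (simp add: mod_eq_dvd_iff algebra_simps)
    then have "P dvd r - s" using pe a by (simp add: prime_elem_dvd_mult_iff)
    then show "r = s" using rs by (auto intro: polys_below_cong_imp_eq)
  qed
  have img: "(\<lambda>r. (a * r) mod P) ` ?R \<subseteq> ?R"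
  proof
    fix y assume "y \<in> (\<lambda>r. (a * r) mod P) ` ?R"
    then obtain r where r: "r \<in> ?R" "y = (a * r) mod P" by auto
    then have "\<not> P dvd a * r" using pe a ndvd by (simp add: prime_elem_dvd_mult_iff)
    then show "y \<in> ?R" using r mod_in_polys_below[OF monic_prime_degree[OF P]]
      by (auto simp: dvd_eq_mod_eq_0)
  qed
  have "bij_betw (\<lambda>r. (a * r) mod P) ?R ?R"
    using endo_inj_surj[OF _ img inj] inj by (simp add: bij_betw_def)
  then have "(\<Prod>r\<in>?R. (a * r) mod P) = \<Prod>?R"
    by (rule prod.reindex_bij_betw)
  then have "(\<Prod>r\<in>?R. a * r) mod P = (\<Prod>?R) mod P"
    by (metis mod_prod_eq)
  then have "P dvd (\<Prod>r\<in>?R. a * r) - \<Prod>?R" by (simp add: mod_eq_dvd_iff)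
  also have "(\<Prod>r\<in>?R. a * r) - \<Prod>?R = (a ^ card ?R - 1) * \<Prod>?R"
    by (simp add: prod.distrib algebra_simps)
  finally have "P dvd a ^ card ?R - 1 \<or> P dvd \<Prod>?R"
    using pe by (simp add: prime_elem_dvd_mult_iff)
  moreover have "\<not> P dvd \<Prod>?R"
  proof -
    have "finite A \<Longrightarrow> A \<subseteq> ?R \<Longrightarrow> \<not> P dvd \<Prod>A" for A
    proof (induction A rule: finite_induct)
      case empty
      then show ?case using pe by (simp add: prime_elem_def)
    next
      case (insert x A)
      then show ?case using ndvd[of x] pe by (simp add: prime_elem_dvd_mult_iff)
    qed
    then show ?thesis by simp
  qed
  moreover have "card ?R = pnorm P - 1"
    by (simp add: card_polys_below pnorm_def)
  ultimately show ?thesis by simp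
qed

text \<open>Lagrange's bound for roots modulo a prime element, kept in the ring instead of its
  quotient: the roots form a set of pairwise incongruent elements, and one of them at a time is
  split off by synthetic division.\<close>

lemma card_roots_mod_prime_le:
  fixes P :: "'b :: idom" and G :: "'b poly"
  assumes P: "prime_elem P"
    and "\<exists>i. \<not> P dvd coeff G i"
    and "finite R" and "\<forall>r\<in>R. P dvd poly G r"
    and "\<forall>r\<in>R. \<forall>s\<in>R. P dvd r - s \<longrightarrow> r = s"
  shows "card R \<le> degree G"
  using assms(2-)
proof (induction "degree G" arbitrary: G R)
  case 0
  then obtain g where g: "G = [:g:]" by (metis degree_eq_zeroE)
  have "\<not> P dvd g"
  proof
    assume "P dvd g"
    then have "P dvd coeff G i" for i using g by (cases i) auto
    then show False using 0(2) by metis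
  qed
  then have "R = {}" using 0(4) g by auto
  then show ?case by simp
next
  case (Suc n)
  show ?case
  proof (cases "R = {}")
    case False
    then obtain r where r: "r \<in> R" by auto
    define Q where "Q = synthetic_div G r"
    have G: "G = [:-r, 1:] * Q + [:poly G r:]"
      unfolding Q_def by (rule synthetic_div_correct'[symmetric])
    have deg: "degree Q = n" using Suc(2) by (simp add: Q_def degree_synthetic_div)
    have "\<exists>i. \<not> P dvd coeff Q i"
    proof (rule ccontr)
      assume "\<not> (\<exists>i. \<not> P dvd coeff Q i)"
      then have Q: "P dvd coeff Q i" for i by auto
      \<comment> \<open>G equals (X - r) Q + G(r) with P dividing G(r), so a quotient that vanishes
        modulo P would make G vanish as well.\<close>
      have "P dvd coeff G i" for i
        by (subst G) (use Q r Suc.prems in \<open>auto simp: coeff_pCons dvd_diff split: nat.splits\<close>)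
      then show False using Suc.prems(1) by metis
    qed
    moreover have "P dvd poly Q s" if "s \<in> R - {r}" for s
    proof -
      have "P dvd poly G s" "P dvd poly G r" using that r Suc.prems by auto
      moreover have "poly G s = (s - r) * poly Q s + poly G r"
        by (subst G) (simp add: algebra_simps)
      ultimately have "P dvd (s - r) * poly Q s" by (simp add: dvd_add_left_iff)
      moreover have "\<not> P dvd s - r" using that r Suc.prems by auto
      ultimately show ?thesis using P by (simp add: prime_elem_dvd_mult_iff)
    qed
    ultimately have "card (R - {r}) \<le> n"
      using Suc.hyps(1)[of Q "R - {r}"] deg Suc.prems by auto
    then show ?thesis using Suc.hyps(2) r Suc.prems by (simp add: card_Diff_singleton)
  qed simp
qed

section \<open>Euler's criterion modulo a prime\<close>

lemma card_le_card_image_mult: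
  assumes "finite A" "f ` A \<subseteq> B" "finite B" "\<And>b. b \<in> B \<Longrightarrow> card {a\<in>A. f a = b} \<le> k"
  shows "card A \<le> k * card B"
proof -
  have "card A = (\<Sum>b\<in>B. card {a\<in>A. f a = b})"
    using assms by (subst card_UN_disjoint[symmetric]) (auto intro!: arg_cong[of _ _ card])
  also have "\<dots> \<le> (\<Sum>b\<in>B. k)" using assms by (intro sum_mono)
  finally show ?thesis by (simp add: mult.commute)
qed

definition residue_squares :: "'a :: {field, finite} poly \<Rightarrow> 'a poly set"
  where "residue_squares P = {r \<in> polys_below (degree P) - {0}. \<exists>x. P dvd x\<^sup>2 - r}"

text \<open>Squaring is at most two-to-one on nonzero residues, since c^2 = a^2 modulo a prime
  forces c = a or c = -a.\<close>

lemma card_residues_le_squares: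
  fixes P :: "'a :: {field, finite} poly"
  assumes P: "P \<in> monic_primes"
  shows "pnorm P - 1 \<le> 2 * card (residue_squares P)"
proof -
  note pe = monic_prime_prime_elem[OF P]
  let ?R = "polys_below (degree P) - {0} :: 'a poly set"
  let ?f = "\<lambda>x. x\<^sup>2 mod P"
  have ndvd: "\<not> P dvd r" if "r \<in> ?R" for r using that polys_below_dvd_imp_0 by auto
  have "card ?R \<le> 2 * card (residue_squares P)"
  proof (rule card_le_card_image_mult[where f = ?f])
    show "?f ` ?R \<subseteq> residue_squares P"
    proof
      fix y assume "y \<in> ?f ` ?R"
      then obtain r where r: "r \<in> ?R" "y = r\<^sup>2 mod P" by auto
      then have "\<not> P dvd r\<^sup>2"
        using pe ndvd by (simp add: prime_elem_dvd_power_iff)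
      moreover have "P dvd r\<^sup>2 - y" using r by (simp add: minus_mod_eq_mult_div)
      ultimately show "y \<in> residue_squares P"
        using r mod_in_polys_below[OF monic_prime_degree[OF P]]
        by (auto simp: residue_squares_def dvd_eq_mod_eq_0)
    qed
    show "card {a \<in> ?R. ?f a = b} \<le> 2" for b
    proof (cases "{a \<in> ?R. ?f a = b} = {}")
      case False
      then obtain a where a: "a \<in> ?R" "?f a = b" by auto
      have "{a \<in> ?R. ?f a = b} \<subseteq> {a, - a}"
      proof
        fix c assume c: "c \<in> {a \<in> ?R. ?f a = b}"
        then have "P dvd c\<^sup>2 - a\<^sup>2" using a by (simp flip: mod_eq_dvd_iff)
        then have "P dvd (c - a) * (c + a)" by (simp add: power2_eq_square algebra_simps)
        then have "P dvd c - a \<or> P dvd c - (- a)" using pe by (simp add: prime_elem_dvd_mult_iff)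
        then show "c \<in> {a, -a}"
          using a c polys_below_cong_imp_eq[of P c a] polys_below_cong_imp_eq[of P c "- a"]
          by (auto simp: polys_below_uminus)
      qed
      then have "card {a \<in> ?R. ?f a = b} \<le> card {a, - a}" by (intro card_mono) auto
      also have "\<dots> \<le> 2" by (simp add: card_insert_if)
      finally show ?thesis .
    qed (simp only: card.empty)
    show "finite (residue_squares P)" by (simp add: residue_squares_def)
  qed simp
  then show ?thesis by (simp add: card_polys_below pnorm_def)
qed

lemma pnorm_prime_gt_1:
  assumes "P \<in> monic_primes" shows "pnorm P > 1"
proof -
  have "card {0, 1 :: 'a} \<le> CARD('a)" by (rule card_mono) auto
  then show ?thesis using monic_prime_degree[OF assms] by (simp add: pnorm_def one_less_power del: One_nat_def)
qed

text \<open>Lagrange's bound for X^m - 1 with m = (|P| - 1)/2. The set \<open>R\<close> is left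
  arbitrary because it is used both for the nonzero squares and for these squares with one further
  residue added.\<close>

lemma euler_residue_roots:
  fixes P :: "'a :: {field, finite} poly"
  assumes odd: "odd CARD('a)" and P: "P \<in> monic_primes"
    and R: "finite R" "\<And>r. r \<in> R \<Longrightarrow> P dvd r ^ ((pnorm P - 1) div 2) - 1"
      "\<And>r s. r \<in> R \<Longrightarrow> s \<in> R \<Longrightarrow> P dvd r - s \<Longrightarrow> r = s"
  shows "card R \<le> (pnorm P - 1) div 2"
proof -
  define m where "m = (pnorm P - 1) div 2"
  \<comment> \<open>For m = 0 the polynomial X^m - 1 would be zero; with m > 0 its coefficient at m
    is 1, which P does not divide.\<close>
  have m: "m > 0"
  proof -
    have "odd (pnorm P)" using odd by (simp add: pnorm_def)
    with pnorm_prime_gt_1[OF P] have "pnorm P \<ge> 3" by presburger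
    then show ?thesis by (simp add: m_def)
  qed
  let ?G = "monom 1 m - 1 :: 'a poly poly"
  have "card R \<le> degree ?G"
  proof (rule card_roots_mod_prime_le[OF monic_prime_prime_elem[OF P]])
    have "coeff ?G m = 1" using m by simp
    moreover have "\<not> P dvd 1" using monic_prime_prime_elem[OF P] by (simp add: prime_elem_def)
    ultimately show "\<exists>i. \<not> P dvd coeff ?G i" by metis
  qed (use R in \<open>auto simp: poly_monom m_def\<close>)
  also have "degree ?G \<le> m" by (intro degree_diff_le) (auto simp: degree_monom_le)
  finally show ?thesis by (simp add: m_def)
qed

lemma dvd_diff_trans: "P dvd x - y \<Longrightarrow> P dvd y - z \<Longrightarrow> P dvd x - z" for P :: "'b :: comm_ring_1"
  using dvd_add[of P "x - y" "y - z"] by simp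

lemma power_cong_mod: "P dvd x - y \<Longrightarrow> P dvd x ^ n - y ^ n" for P :: "'b :: comm_ring_1"
  by (metis dvd_trans dvd_triv_left power_diff_sumr2)

lemma residue_squares_power:
  fixes P :: "'a :: {field, finite} poly"
  assumes odd: "odd CARD('a)" and P: "P \<in> monic_primes" and r: "r \<in> residue_squares P"
  shows "P dvd r ^ ((pnorm P - 1) div 2) - 1"
proof -
  obtain x where x: "P dvd x\<^sup>2 - r" using r by (auto simp: residue_squares_def)
  have "\<not> P dvd r" using r polys_below_dvd_imp_0 by (auto simp: residue_squares_def)
  then have "\<not> P dvd x\<^sup>2" using x dvd_diff[OF _ x, of "x\<^sup>2"] by auto
  then have "\<not> P dvd x" by (auto simp: power2_eq_square)
  then have "P dvd x ^ (pnorm P - 1) - 1" by (rule fermat_mod_prime[OF P])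
  moreover have "even (pnorm P - 1)" using odd pnorm_prime_gt_1[OF P] by (simp add: pnorm_def)
  ultimately have "P dvd (x\<^sup>2) ^ ((pnorm P - 1) div 2) - 1" by (simp flip: power_mult)
  moreover have "P dvd (x\<^sup>2) ^ ((pnorm P - 1) div 2) - r ^ ((pnorm P - 1) div 2)"
    using x by (rule power_cong_mod)
  ultimately show ?thesis by (meson dvd_diff_trans dvd_diff_commute)
qed

lemma card_residue_squares:
  fixes P :: "'a :: {field, finite} poly"
  assumes odd: "odd CARD('a)" and P: "P \<in> monic_primes"
  shows "card (residue_squares P) = (pnorm P - 1) div 2"
proof (rule antisym)
  show "card (residue_squares P) \<le> (pnorm P - 1) div 2"
    using residue_squares_power[OF odd P]
    by (intro euler_residue_roots[OF odd P])
      (auto intro: polys_below_cong_imp_eq simp: residue_squares_def)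
  show "(pnorm P - 1) div 2 \<le> card (residue_squares P)"
    using card_residues_le_squares[OF P] by linarith
qed

text \<open>The nonzero squares already exhaust the (|P| - 1)/2 roots allowed to X^((|P| - 1)/2) -
  1. A nonsquare satisfying the same congruence would be one root too many.\<close>

lemma euler_criterion_mod_prime:
  fixes P a :: "'a :: {field, finite} poly"
  assumes odd: "odd CARD('a)" and P: "P \<in> monic_primes"
    and a: "P dvd a ^ ((pnorm P - 1) div 2) - 1"
  shows "\<exists>x. P dvd x\<^sup>2 - a"
proof (rule ccontr)
  assume nsq: "\<nexists>x. P dvd x\<^sup>2 - a"
  let ?b = "a mod P"
  have ab: "P dvd a - ?b" by (simp add: minus_mod_eq_mult_div)
  have b: "?b \<in> polys_below (degree P)" by (rule mod_in_polys_below[OF monic_prime_degree[OF P]])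
  have "?b \<notin> residue_squares P"
  proof
    assume "?b \<in> residue_squares P"
    then obtain x where "P dvd x\<^sup>2 - ?b" by (auto simp: residue_squares_def)
    moreover have "P dvd ?b - a" using ab by (simp only: dvd_diff_commute)
    ultimately have "P dvd x\<^sup>2 - a" by (rule dvd_diff_trans)
    with nsq show False by blast
  qed
  have "P dvd a ^ ((pnorm P - 1) div 2) - ?b ^ ((pnorm P - 1) div 2)"
    using ab by (rule power_cong_mod)
  then have "P dvd ?b ^ ((pnorm P - 1) div 2) - 1"
    using a by (meson dvd_diff_trans dvd_diff_commute)
  then have "card (insert ?b (residue_squares P)) \<le> (pnorm P - 1) div 2"
    using b residue_squares_power[OF odd P]
    by (intro euler_residue_roots[OF odd P])
      (auto intro: polys_below_cong_imp_eq simp: residue_squares_def)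
  then show False
    using \<open>?b \<notin> residue_squares P\<close> card_residue_squares[OF odd P]
    by (simp add: card_insert_disjoint residue_squares_def)
qed

section \<open>The Frobenius map and reciprocity for the indeterminate\<close>

lemma indet_monic_prime [simp]: "(indet :: 'a :: {field, finite} poly) \<in> monic_primes"
  by (simp add: monic_primes_def irreducible_linear_field_poly)

lemma indet_dvd_iff: "indet dvd f \<longleftrightarrow> poly f 0 = (0 :: 'a :: field)"
  using poly_eq_0_iff_dvd[of f 0] by simp

lemma pnorm_indet: "pnorm (indet :: 'a :: {field, finite} poly) = CARD('a)"
  by (simp add: pnorm_def)

text \<open>The constants are the residues modulo T and |T| = q, so this is Fermat's theorem for P =
  T.\<close>

lemma finite_field_fermat:
  fixes c :: "'a :: {field, finite}"
  assumes "c \<noteq> 0" shows "c ^ (CARD('a) - 1) = 1"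
  using fermat_mod_prime[of indet "[:c:]"] assms by (simp add: indet_dvd_iff pnorm_indet)

lemma finite_field_power_card: "c ^ CARD('a) = (c :: 'a :: {field, finite})"
proof (cases "c = 0")
  case False
  have "c ^ CARD('a) = c * c ^ (CARD('a) - 1)" by (subst power_eq_if) simp
  also have "c ^ (CARD('a) - 1) = 1" using False by (rule finite_field_fermat)
  finally show ?thesis by simp
qed simp

lemma card_field_gt_1: "CARD('a :: {field, finite}) > 1"
  using pnorm_prime_gt_1[of "indet :: 'a poly"] by (simp add: pnorm_indet)

text \<open>The characteristic of the field never enters: (1 + T)^q - T^q - 1 has degree below q but
  vanishes at all q elements of the field, so it is zero, and its coefficients are these
  binomials.\<close>

lemma card_choose_eq_0:
  assumes "0 < i" "i < CARD('a :: {field, finite})"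
  shows "of_nat (CARD('a) choose i) = (0 :: 'a)"
proof -
  let ?q = "CARD('a)"
  let ?p = "[:1, 1:] ^ ?q - monom 1 ?q - 1 :: 'a poly"
  have "?p = 0"
  proof (rule ccontr)
    assume p: "?p \<noteq> 0"
    have "poly ?p c = 0" for c by (simp add: poly_power poly_monom finite_field_power_card)
    then have "?q = card {c. poly ?p c = 0}" by simp
    also have "\<dots> \<le> degree ?p" by (rule card_poly_roots_bound[OF p])
    also have "degree ?p < ?q"
    proof (rule degree_lessI)
      show "\<forall>k\<ge>?q. coeff ?p k = 0"
        using card_field_gt_1[where ?'a = 'a]
        by (auto simp: coeff_linear_poly_power le_less degree_linear_power coeff_eq_0)
    qed (use p in auto)
    finally show False by simp
  qed
  then have "coeff ?p i = 0" by simp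
  then show ?thesis using assms by (simp add: coeff_linear_poly_power)
qed

lemma power_card_add:
  fixes a b :: "'a :: {field, finite} poly"
  shows "(a + b) ^ CARD('a) = a ^ CARD('a) + b ^ CARD('a)"
proof -
  let ?q = "CARD('a)"
  have z: "(of_nat (?q choose k) :: 'a poly) = 0" if "k \<in> {..?q} - {0, ?q}" for k
    using card_choose_eq_0[where ?'a = 'a, of k] that by (simp add: of_nat_poly)
  have "(a + b) ^ ?q = (\<Sum>k\<in>{..?q}. of_nat (?q choose k) * a ^ k * b ^ (?q - k))"
    by (simp add: binomial_ring)
  also have "\<dots> = (\<Sum>k\<in>{0, ?q}. of_nat (?q choose k) * a ^ k * b ^ (?q - k))"
    by (rule sum.mono_neutral_right) (auto simp: z)
  also have "\<dots> = a ^ ?q + b ^ ?q"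
    using card_field_gt_1[where ?'a = 'a] by simp
  finally show ?thesis .
qed

lemma power_card_power_add:
  fixes a b :: "'a :: {field, finite} poly"
  shows "(a + b) ^ (CARD('a) ^ i) = a ^ (CARD('a) ^ i) + b ^ (CARD('a) ^ i)"
proof (induction i)
  case (Suc i)
  then show ?case
    by (simp add: power_card_add power_mult mult.commute[of "CARD('a)"])
qed simp

lemma finite_field_power_card_power: "c ^ (CARD('a) ^ i) = (c :: 'a :: {field, finite})"
  by (induction i) (simp_all add: power_mult finite_field_power_card)

text \<open>The power map with exponent q^i is additive and fixes every constant, so it acts on T
  alone.\<close>

lemma frobenius_pcompose:
  fixes f :: "'a :: {field, finite} poly"
  shows "f ^ (CARD('a) ^ i) = pcompose f (indet ^ (CARD('a) ^ i))"
proof (induction f)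
  case (pCons a f)
  have "pCons a f = [:a:] + indet * f" by simp
  then have "(pCons a f) ^ (CARD('a) ^ i) =
      [:a:] ^ (CARD('a) ^ i) + indet ^ (CARD('a) ^ i) * f ^ (CARD('a) ^ i)"
    by (simp only: power_card_power_add power_mult_distrib)
  also have "[:a:] ^ (CARD('a) ^ i) = [:a:]"
    by (simp add: poly_const_pow finite_field_power_card_power)
  finally show ?case by (simp add: pcompose_pCons pCons.IH)
qed (simp add: power_0_left)

text \<open>The polynomial on the left is f read in a second variable over F_q[T]; in this reading P
  acquires roots modulo itself, as the reciprocity argument requires.\<close>

lemma poly_map_const: "poly (map_poly (\<lambda>c. [:c:]) f) g = pcompose f g"
  by (induction f) (auto simp: map_poly_pCons pcompose_pCons)

text \<open>If two conjugates of T agreed modulo P, then f^(q^j) and f^(q^i) would agree for every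
  f. All q^(deg P) residues would then be roots of X^(q^j) - X^(q^i), whose degree q^j is
  smaller.\<close>

lemma frobenius_conjugates_incongruent:
  fixes P :: "'a :: {field, finite} poly"
  assumes P: "P \<in> monic_primes" and ij: "i < j" "j < degree P"
  shows "\<not> P dvd indet ^ (CARD('a) ^ j) - indet ^ (CARD('a) ^ i)"
proof
  let ?q = "CARD('a)"
  assume dvd: "P dvd indet ^ (?q ^ j) - indet ^ (?q ^ i)"
  let ?G = "monom 1 (?q ^ j) - monom 1 (?q ^ i) :: 'a poly poly"
  note q = card_field_gt_1[where ?'a = 'a]
  have lt: "?q ^ i < ?q ^ j" using ij q by (simp add: power_strict_increasing)
  have "P dvd poly ?G f" for f
  proof -
    have "P dvd pcompose f x - pcompose f y" if "P dvd x - y" for x y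
      using that
    proof (induction f)
      case (pCons a f)
      have "x * pcompose f x - y * pcompose f y =
          (x - y) * pcompose f x + y * (pcompose f x - pcompose f y)"
        by (simp add: algebra_simps)
      with pCons show ?case by (simp add: pcompose_pCons)
    qed simp
    then have "P dvd pcompose f (indet ^ (?q ^ j)) - pcompose f (indet ^ (?q ^ i))" using dvd by blast
    then show ?thesis by (simp add: poly_monom frobenius_pcompose[of f])
  qed
  note G = this
  have "card (polys_below (degree P) :: 'a poly set) \<le> degree ?G"
  proof (rule card_roots_mod_prime_le[OF monic_prime_prime_elem[OF P]])
    have "coeff ?G (?q ^ j) = 1" using lt by simp
    moreover have "\<not> P dvd 1" using monic_prime_prime_elem[OF P] by (simp add: prime_elem_def)
    ultimately show "\<exists>i. \<not> P dvd coeff ?G i" by metis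
    show "\<forall>r\<in>polys_below (degree P). P dvd poly ?G r" using G by blast
  qed (auto intro: polys_below_cong_imp_eq)
  also have "degree ?G \<le> ?q ^ j"
    using lt by (intro degree_diff_le) (auto simp: degree_monom_le intro: order_trans[OF degree_monom_le])
  also have "?q ^ j < ?q ^ degree P" using ij q by (simp add: power_strict_increasing)
  finally show False by (simp add: card_polys_below)
qed

text \<open>Modulo \<open>P\<close> the polynomial \<open>P\<close> splits over the Frobenius conjugates of \<open>T\<close>; this is the constant
  coefficient of that factorization.\<close>

lemma reciprocity_indet:
  fixes P :: "'a :: {field, finite} poly"
  assumes odd: "odd CARD('a)" and P: "P \<in> monic_primes"
  shows "P dvd (- indet) ^ (\<Sum>i<degree P. CARD('a) ^ i) - [:coeff P 0:]"
proof -
  let ?q = "CARD('a)" and ?d = "degree P"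
  let ?t = "\<lambda>i. indet ^ (?q ^ i) :: 'a poly"
  define L where "L = map_poly (\<lambda>c. [:c:]) P"
  define E where "E = (\<Prod>i<?d. [:- ?t i, 1:])"
  define R where "R = ?t ` {..<?d}"
  note d = monic_prime_degree[OF P] and lc = monic_prime_lead_coeff[OF P]
  have inc: "i = j" if "i < ?d" "j < ?d" "P dvd ?t i - ?t j" for i j
    using that frobenius_conjugates_incongruent[OF P, of i j]
      frobenius_conjugates_incongruent[OF P, of j i]
    by (metis dvd_diff_commute nat_neq_iff)
  have "inj_on ?t {..<?d}"
    by (rule inj_onI) (auto intro!: inc)
  then have cR: "card R = ?d" by (simp add: R_def card_image)
  have degE: "degree E = ?d"
    by (simp add: E_def degree_prod_eq_sum_degree)
  have lcE: "lead_coeff E = 1"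
    unfolding E_def lead_coeff_prod by simp
  have degL: "degree L = ?d" and coL: "coeff L i = [:coeff P i:]" for i
    by (auto simp: L_def degree_map_poly coeff_map_poly)
  \<comment> \<open>Both \<open>L\<close> and \<open>E\<close> are monic of degree d, so their
    difference has degree below d; yet it has the d incongruent conjugates of T as roots modulo P,
    so it vanishes modulo P.\<close>
  have "P dvd coeff (L - E) i" for i
  proof (rule ccontr)
    assume i: "\<not> P dvd coeff (L - E) i"
    have "card R \<le> degree (L - E)"
    proof (rule card_roots_mod_prime_le[OF monic_prime_prime_elem[OF P]])
      show "\<forall>r\<in>R. P dvd poly (L - E) r"
      proof
        fix r assume "r \<in> R"
        then obtain j where j: "j < ?d" "r = ?t j" by (auto simp: R_def)
        have "poly L r = P ^ (?q ^ j)"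
          by (simp add: L_def poly_map_const j frobenius_pcompose[of P])
        then have "P dvd poly L r" by (simp add: dvd_power)
        moreover have "poly E r = 0" using j by (auto simp: E_def poly_prod)
        ultimately show "P dvd poly (L - E) r" by simp
      qed
    qed (use i inc in \<open>auto simp: R_def\<close>)
    moreover have "degree (L - E) < ?d"
    proof (rule degree_lessI)
      show "\<forall>k\<ge>?d. coeff (L - E) k = 0"
        using lc lcE degE degL by (auto simp: le_less coL coeff_eq_0 one_pCons)
    qed (use d in auto)
    ultimately show False using cR by simp
  qed
  from this[of 0] have "P dvd coeff L 0 - coeff E 0" by simp
  moreover have "coeff E 0 = (\<Prod>i<?d. - ?t i)"
    by (simp add: E_def poly_prod flip: poly_0_coeff_0)
  \<comment> \<open>Every q^i is odd, so each sign can be moved inside the power.\<close>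
  moreover have "(\<Prod>i<?d. - ?t i) = (- indet) ^ (\<Sum>i<?d. ?q ^ i)"
    unfolding power_sum using odd by (intro prod.cong refl power_minus_odd[symmetric]) simp
  ultimately show ?thesis by (simp add: coL dvd_diff_commute)
qed

section \<open>The norm form, and the quadratic character of the constant field\<close>

definition representable :: "'a :: comm_ring_1 poly \<Rightarrow> bool"
  where "representable f \<longleftrightarrow> (\<exists>A B. f = A\<^sup>2 + indet * B\<^sup>2)"

lemma representable_square: "representable (A\<^sup>2)"
  unfolding representable_def by (rule exI[of _ A], rule exI[of _ 0]) simp

text \<open>The form is the norm from F_q[T][sqrt(-T)], and the identity used is the
  multiplicativity of that norm.\<close>

lemma representable_mult:
  assumes "representable f" "representable g" shows "representable (f * g)"
proof -
  obtain A B C D where "f = A\<^sup>2 + indet * B\<^sup>2" "g = C\<^sup>2 + indet * D\<^sup>2"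
    using assms by (auto simp: representable_def)
  moreover have "(A\<^sup>2 + t * B\<^sup>2) * (C\<^sup>2 + t * D\<^sup>2) = (A * C - t * (B * D))\<^sup>2 + t * (A * D + B * C)\<^sup>2" for t
    by (simp add: power2_eq_square algebra_simps)
  ultimately have "f * g = (A * C - indet * (B * D))\<^sup>2 + indet * (A * D + B * C)\<^sup>2"
    by blast
  then show ?thesis unfolding representable_def by blast
qed

text \<open>In the field q = binomial(q, 1) = 0; if 2 were 0 too, the odd number q would also equal
  1.\<close>

lemma two_neq_0:
  assumes "odd CARD('a :: {field, finite})" shows "(2 :: 'a) \<noteq> 0"
proof
  assume "(2 :: 'a) = 0"
  moreover obtain k where k: "CARD('a) = 2 * k + 1" using assms oddE by blast
  moreover have "of_nat (CARD('a) choose 1) = (0 :: 'a)"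
    using card_field_gt_1[where ?'a = 'a] by (intro card_choose_eq_0) auto
  ultimately show False by simp
qed

lemma square_iff_power_eq_1:
  fixes c :: "'a :: {field, finite}"
  assumes odd: "odd CARD('a)" and c: "c \<noteq> 0"
  shows "(\<exists>s. c = s\<^sup>2) \<longleftrightarrow> c ^ ((CARD('a) - 1) div 2) = 1"
proof
  assume "\<exists>s. c = s\<^sup>2"
  then obtain s where s: "c = s\<^sup>2" by blast
  have "c ^ ((CARD('a) - 1) div 2) = s ^ (2 * ((CARD('a) - 1) div 2))"
    unfolding s by (simp only: power_mult)
  also have "2 * ((CARD('a) - 1) div 2) = CARD('a) - 1" using odd by simp
  also have "s ^ \<dots> = 1" using s c by (intro finite_field_fermat) auto
  finally show "c ^ ((CARD('a) - 1) div 2) = 1" .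
next
  assume "c ^ ((CARD('a) - 1) div 2) = 1"
  then have "\<exists>x. indet dvd x\<^sup>2 - [:c:]"
    by (intro euler_criterion_mod_prime odd indet_monic_prime)
      (simp add: indet_dvd_iff pnorm_indet)
  then show "\<exists>s. c = s\<^sup>2" by (auto simp: indet_dvd_iff)
qed

lemma power_half_card_cases:
  fixes c :: "'a :: {field, finite}"
  assumes odd: "odd CARD('a)" and c: "c \<noteq> 0"
  shows "c ^ ((CARD('a) - 1) div 2) = 1 \<or> c ^ ((CARD('a) - 1) div 2) = -1"
proof -
  have "(c ^ ((CARD('a) - 1) div 2))\<^sup>2 = c ^ ((CARD('a) - 1) div 2 * 2)"
    by (simp only: power_mult)
  also have "(CARD('a) - 1) div 2 * 2 = CARD('a) - 1" using odd by simp
  also have "c ^ \<dots> = 1" using c by (rule finite_field_fermat)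
  finally show ?thesis by (simp only: power2_eq_1_iff)
qed

text \<open>The quadratic character of F_q, real-valued because it provides coefficients of real
  power series. Applied to f(0) it is the Legendre symbol of f modulo T.\<close>

definition chi :: "'a :: {field, finite} \<Rightarrow> real"
  where "chi c = (if c = 0 then 0 else if \<exists>s. c = s\<^sup>2 then 1 else -1)"

lemma chi_mult:
  fixes x y :: "'a :: {field, finite}"
  assumes odd: "odd CARD('a)" shows "chi (x * y) = chi x * chi y"
proof (cases "x = 0 \<or> y = 0")
  case False
  have "(1 :: 'a) \<noteq> - 1" using two_neq_0[OF odd] by (metis add.right_inverse one_add_one)
  with False show ?thesis
    using power_half_card_cases[OF odd, of x] power_half_card_cases[OF odd, of y]
    by (auto simp: chi_def square_iff_power_eq_1[OF odd] power_mult_distrib simp del: One_nat_def)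
qed (auto simp: chi_def)

lemma card_nonzero_squares:
  assumes odd: "odd CARD('a :: {field, finite})"
  shows "card {c :: 'a. c \<noteq> 0 \<and> (\<exists>s. c = s\<^sup>2)} = (CARD('a) - 1) div 2"
proof -
  have "residue_squares indet = (\<lambda>c. [:c:]) ` {c :: 'a. c \<noteq> 0 \<and> (\<exists>s. c = s\<^sup>2)}"
  proof (intro equalityI subsetI)
    fix r :: "'a poly" assume r: "r \<in> residue_squares indet"
    then have "degree r = 0" using polys_below_iff_degree[of 1 r]
      by (auto simp: residue_squares_def)
    then obtain c where "r = [:c:]" using degree_0_id by metis
    with r show "r \<in> (\<lambda>c. [:c:]) ` {c :: 'a. c \<noteq> 0 \<and> (\<exists>s. c = s\<^sup>2)}"
      by (auto simp: residue_squares_def indet_dvd_iff)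
  next
    fix r :: "'a poly" assume "r \<in> (\<lambda>c. [:c:]) ` {c :: 'a. c \<noteq> 0 \<and> (\<exists>s. c = s\<^sup>2)}"
    then obtain s where s: "r = [:s\<^sup>2:]" "s \<noteq> 0" by auto
    have "indet dvd [:s:]\<^sup>2 - r" by (simp add: s indet_dvd_iff)
    then have "\<exists>x. indet dvd x\<^sup>2 - r" by blast
    moreover have "r \<in> polys_below (degree (indet :: 'a poly))"
      using s by (simp add: polys_below_iff_degree)
    ultimately show "r \<in> residue_squares indet"
      using s by (simp add: residue_squares_def)
  qed
  then have "card (residue_squares (indet :: 'a poly)) = card {c :: 'a. c \<noteq> 0 \<and> (\<exists>s. c = s\<^sup>2)}"
    by (simp add: card_image inj_on_def)
  then show ?thesis using card_residue_squares[OF odd indet_monic_prime] by (simp add: pnorm_indet)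
qed

lemma sum_chi:
  assumes odd: "odd CARD('a :: {field, finite})"
  shows "(\<Sum>c\<in>UNIV. chi (c :: 'a)) = 0"
proof -
  let ?S = "{c :: 'a. c \<noteq> 0 \<and> (\<exists>s. c = s\<^sup>2)}"
  let ?N = "UNIV - {0} - ?S"
  have "(\<Sum>c\<in>UNIV. chi (c :: 'a)) = (\<Sum>c\<in>UNIV - {0}. chi (c :: 'a))"
    using sum.remove[of UNIV 0 "chi :: 'a \<Rightarrow> real"] by (simp add: chi_def)
  also have "\<dots> = (\<Sum>c\<in>?N. chi c) + (\<Sum>c\<in>?S. chi c)"
    by (rule sum.subset_diff) auto
  also have "(\<Sum>c\<in>?N. chi c) = (\<Sum>c\<in>?N. -1)"
    by (intro sum.cong) (auto simp: chi_def)
  also have "(\<Sum>c\<in>?S. chi c) = (\<Sum>c\<in>?S. 1)"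
    by (intro sum.cong) (auto simp: chi_def)
  also have "card ?N = CARD('a) - 1 - card ?S"
    by (subst card_Diff_subset) auto
  then have "(\<Sum>c\<in>?N. -1) + (\<Sum>c\<in>?S. 1) = (0 :: real)"
    using card_nonzero_squares[OF odd] odd card_field_gt_1[where ?'a = 'a]
    by (auto elim!: oddE)
  finally show ?thesis .
qed

text \<open>Modulo T a polynomial is its constant coefficient, so Euler's criterion in F_q evaluates
  the symbol; 1 and -1 differ for odd q, which makes the description unique. A vanishing constant
  coefficient counts as the square of 0, so T is not inert.\<close>

lemma inert_primes_eq:
  assumes odd: "odd CARD('a :: {field, finite})"
  shows "inert_primes = {P :: 'a poly. P \<in> monic_primes \<and> (\<nexists>s. coeff P 0 = s\<^sup>2)}"
proof -
  define m where "m = (CARD('a) - 1) div 2"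
  have neq: "(1 :: 'a) \<noteq> - 1" using two_neq_0[OF odd] by (metis add.right_inverse one_add_one)
  have m: "m > 0" using odd card_field_gt_1[where ?'a = 'a] by (auto simp: m_def elim!: oddE)
  have leg: "legendre P indet = (THE s. s \<in> {0, 1, -1} \<and> (coeff P 0) ^ m = of_int s)" for P :: "'a poly"
    by (simp add: legendre_def cong_def mod_eq_dvd_iff indet_dvd_iff pnorm_indet m_def
        of_int_poly flip: poly_0_coeff_0)
  have "legendre P indet = -1 \<longleftrightarrow> (\<nexists>s. coeff P 0 = s\<^sup>2)" for P :: "'a poly"
  proof -
    have uniq: "legendre P indet = s" if "s \<in> {0, 1, -1}" "(coeff P 0) ^ m = of_int s" for s
      unfolding leg using that neq by (intro the_equality) auto
    consider "coeff P 0 = 0" | "coeff P 0 \<noteq> 0" "(coeff P 0) ^ m = 1" | "coeff P 0 \<noteq> 0" "(coeff P 0) ^ m = - 1"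
      using power_half_card_cases[OF odd, of "coeff P 0"] m_def by blast
    then show ?thesis
    proof cases
      case 1
      then have "coeff P 0 = 0\<^sup>2" "legendre P indet = 0" using m by (auto intro!: uniq simp: power_0_left)
      then show ?thesis by (metis one_neq_neg_one zero_neq_neg_one)
    next
      case 2
      then show ?thesis using uniq[of 1] square_iff_power_eq_1[OF odd, of "coeff P 0"] by (simp add: m_def)
    next
      case 3
      then show ?thesis using uniq[of "-1"] square_iff_power_eq_1[OF odd, of "coeff P 0"] neq
        by (simp add: m_def)
    qed
  qed
  then show ?thesis by (auto simp: inert_primes_def)
qed

section \<open>Primes represented by the form\<close>

text \<open>With d = deg P, the pairs (X, Y) number q^(d + 1), because d div 2 + (d - 1) div 2 = d -
  1, while there are only q^d residues. The strict bound on Y keeps the degree of T Y^2, which is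
  odd, within d.\<close>

lemma thue_poly:
  fixes P C :: "'a :: {field, finite} poly"
  assumes d: "degree P > 0"
  shows "\<exists>X Y. (X \<noteq> 0 \<or> Y \<noteq> 0) \<and> 2 * degree X \<le> degree P \<and> 2 * degree Y < degree P \<and> P dvd X - C * Y"
proof -
  let ?U = "polys_below (degree P div 2 + 1) :: 'a poly set"
  let ?V = "polys_below ((degree P - 1) div 2 + 1) :: 'a poly set"
  let ?f = "\<lambda>(X, Y). (X - C * Y) mod P"
  have "\<not> inj_on ?f (?U \<times> ?V)"
  proof
    assume "inj_on ?f (?U \<times> ?V)"
    then have "card (?U \<times> ?V) \<le> card (polys_below (degree P) :: 'a poly set)"
      using mod_in_polys_below[OF d] by (intro card_inj_on_le[of ?f]) auto
    then have "CARD('a) ^ (degree P div 2 + 1 + ((degree P - 1) div 2 + 1)) \<le> CARD('a) ^ degree P"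
      by (simp only: card_cartesian_product card_polys_below power_add)
    then have "degree P div 2 + 1 + ((degree P - 1) div 2 + 1) \<le> degree P"
      using card_field_gt_1[where ?'a = 'a] power_increasing_iff by blast
    with d show False by presburger
  qed
  then obtain X1 Y1 X2 Y2 where XY: "X1 \<in> ?U" "X2 \<in> ?U" "Y1 \<in> ?V" "Y2 \<in> ?V"
      "(X1, Y1) \<noteq> (X2, Y2)" "(X1 - C * Y1) mod P = (X2 - C * Y2) mod P"
    by (auto simp: inj_on_def)
  have "X1 - X2 \<in> ?U" "Y1 - Y2 \<in> ?V" using XY by (simp_all add: polys_below_diff)
  then have "2 * degree (X1 - X2) \<le> degree P" "2 * degree (Y1 - Y2) < degree P"
    using d by (auto simp: polys_below_iff_degree)
  moreover have "P dvd (X1 - X2) - C * (Y1 - Y2)"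
    using XY(6) by (simp add: mod_eq_dvd_iff algebra_simps)
  moreover have "X1 - X2 \<noteq> 0 \<or> Y1 - Y2 \<noteq> 0" using XY(5) by auto
  ultimately show ?thesis by blast
qed

text \<open>
  Thue's pigeonhole argument. The terms \<open>X\<^sup>2\<close> and \<open>T Y\<^sup>2\<close> have degrees of different parity, so their sum is
  nonzero with a square as leading coefficient, which forces it to be a square constant times \<open>P\<close>.
\<close>

lemma representable_if_minus_indet_square_mod:
  fixes P C :: "'a :: {field, finite} poly"
  assumes d: "degree P > 0" and lc: "lead_coeff P = 1" and C: "P dvd C\<^sup>2 + indet"
  shows "representable P"
proof -
  obtain X Y where XY: "X \<noteq> 0 \<or> Y \<noteq> 0" "2 * degree X \<le> degree P" "2 * degree Y < degree P"
      "P dvd X - C * Y"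
    using thue_poly[OF d] by blast
  let ?N = "X\<^sup>2 + indet * Y\<^sup>2"
  \<comment> \<open>Modulo P one has X = C Y and C^2 = -T, so the norm of (X, Y) vanishes.\<close>
  have "?N = (X - C * Y) * (X + C * Y) + (C\<^sup>2 + indet) * Y\<^sup>2" by algebra
  then have dvd: "P dvd ?N" using XY(4) C by (metis dvd_add dvd_mult2)
  have dX: "degree (X\<^sup>2) = 2 * degree X" and lX: "lead_coeff (X\<^sup>2) = (lead_coeff X)\<^sup>2"
    by (simp_all add: degree_power_eq lead_coeff_power power2_eq_square degree_mult_eq_0 degree_mult_eq lead_coeff_mult)
      (cases "X = 0"; simp add: degree_mult_eq)
  have dY: "degree (indet * Y\<^sup>2) = Suc (2 * degree Y)" if "Y \<noteq> 0"
    using that by (simp add: degree_mult_eq power2_eq_square)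
  have lY: "lead_coeff (indet * Y\<^sup>2) = (lead_coeff Y)\<^sup>2"
    by (simp add: lead_coeff_mult lead_coeff_power)
  have N: "degree ?N \<le> degree P \<and> (\<exists>s. s \<noteq> 0 \<and> lead_coeff ?N = s\<^sup>2)"
  proof (cases "Y = 0")
    case True
    then show ?thesis using XY dX lX by (intro conjI exI[of _ "lead_coeff X"]) auto
  next
    case Y: False
    show ?thesis
    proof (cases "X = 0")
      case True
      then show ?thesis using XY dY lY Y by (intro conjI exI[of _ "lead_coeff Y"]) auto
    next
      case X: False
      have "degree (X\<^sup>2) < degree (indet * Y\<^sup>2) \<or> degree (indet * Y\<^sup>2) < degree (X\<^sup>2)"
        using dX dY Y by presburger
      then show ?thesis
      proof
        assume lt: "degree (X\<^sup>2) < degree (indet * Y\<^sup>2)"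
        have "degree ?N = degree (indet * Y\<^sup>2)" by (rule degree_add_eq_right[OF lt])
        moreover have "lead_coeff ?N = (lead_coeff Y)\<^sup>2" using lead_coeff_add_le[OF lt] lY by simp
        ultimately show ?thesis using Y XY dY by (metis Suc_leI leading_coeff_0_iff)
      next
        assume lt: "degree (indet * Y\<^sup>2) < degree (X\<^sup>2)"
        have "degree ?N = degree (X\<^sup>2)" by (rule degree_add_eq_left[OF lt])
        moreover have "lead_coeff ?N = (lead_coeff X)\<^sup>2"
          using lead_coeff_add_le[OF lt] lX by (simp add: add.commute)
        ultimately show ?thesis using X XY dX by (metis leading_coeff_0_iff)
      qed
    qed
  qed
  then obtain s where s: "s \<noteq> 0" "lead_coeff ?N = s\<^sup>2" by blast
  have "?N \<noteq> 0"
  proof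
    assume "?N = 0"
    then have "lead_coeff ?N = 0" by (simp only: leading_coeff_0_iff)
    then show False using s by (metis zero_eq_power2)
  qed
  obtain R where R: "?N = P * R" using dvd by blast
  with \<open>?N \<noteq> 0\<close> have "P \<noteq> 0" "R \<noteq> 0" by auto
  then have "degree P + degree R \<le> degree P" using N R degree_mult_eq[of P R] by simp
  then obtain r where r: "R = [:r:]" by (metis add_le_same_cancel1 degree_eq_zeroE le_zero_eq)
  have "r = s\<^sup>2"
  proof -
    have "s\<^sup>2 = lead_coeff (P * R)" unfolding R[symmetric] by (rule s(2)[symmetric])
    also have "\<dots> = lead_coeff P * lead_coeff R" by (rule lead_coeff_mult)
    also have "\<dots> = r" using lc r by simp
    finally show ?thesis by simp
  qed
  then have "smult (s\<^sup>2) P = ?N" using R r by simp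
  then have "P = smult (inverse (s\<^sup>2)) ?N" using s by (metis smult_smult left_inverse smult_1_left zero_eq_power2)
  also have "\<dots> = (smult (inverse s) X)\<^sup>2 + indet * (smult (inverse s) Y)\<^sup>2"
    by (simp add: smult_add_right smult_power power_inverse)
  finally show ?thesis unfolding representable_def by blast
qed

text \<open>Reciprocity gives (-T)^((|P| - 1)/(q - 1)) = P(0) modulo P. Raising it to the power (q -
  1)/2 shows that -T is a quadratic residue when P(0) is a nonzero square. If P(0) = 0 then P = T,
  which is 0^2 + T 1^2.\<close>

lemma representable_split_prime:
  fixes P :: "'a :: {field, finite} poly"
  assumes odd: "odd CARD('a)" and P: "P \<in> monic_primes" "P \<notin> inert_primes"
  shows "representable P"
proof -
  obtain s where s: "coeff P 0 = s\<^sup>2" using P by (auto simp: inert_primes_eq[OF odd])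
  let ?q = "CARD('a)"
  let ?M = "\<Sum>i<degree P. ?q ^ i" and ?m = "(?q - 1) div 2"
  note q = card_field_gt_1[where ?'a = 'a]
  have d: "degree P > 0" using P monic_prime_degree by auto
  show ?thesis
  proof (cases "s = 0")
    case True
    then have "indet dvd P" using s by (simp add: indet_dvd_iff poly_0_coeff_0)
    then have "P = indet" using monic_primes_dvd_imp_eq[OF indet_monic_prime P(1)] by simp
    then show ?thesis unfolding representable_def by (intro exI[of _ 0] exI[of _ 1]) simp
  next
    case False
    have M: "(?q - 1) * (\<Sum>i<n. ?q ^ i) = ?q ^ n - 1" for n
    proof (induction n)
      case (Suc n)
      have "?q ^ n \<ge> 1" using q by simp
      with Suc show ?case by (simp add: distrib_left diff_mult_distrib)
    qed simp
    have "P dvd ((- indet) ^ ?M) ^ ?m - [:s\<^sup>2:] ^ ?m"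
      using reciprocity_indet[OF odd P(1)] s by (intro power_cong_mod) simp
    moreover have "[:s\<^sup>2:] ^ ?m = 1"
    proof -
      have "(s\<^sup>2) ^ ?m = 1" using False square_iff_power_eq_1[OF odd, of "s\<^sup>2"] by auto
      then show ?thesis by (simp add: poly_const_pow one_pCons)
    qed
    moreover have "?M * ?m = (pnorm P - 1) div 2"
    proof -
      have "pnorm P - 1 = ?M * (2 * ?m)" using M odd by (simp add: pnorm_def mult.commute)
      then show ?thesis by simp
    qed
    ultimately have "P dvd (- indet) ^ ((pnorm P - 1) div 2) - 1"
      by (simp flip: power_mult)
    then obtain x where "P dvd x\<^sup>2 - (- indet)"
      using euler_criterion_mod_prime[OF odd P(1)] by blast
    then have "P dvd x\<^sup>2 + indet" by (simp only: diff_minus_eq_add)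
    then show ?thesis
      using representable_if_minus_indet_square_mod[OF d monic_prime_lead_coeff[OF P(1)], of x] by simp
  qed
qed

text \<open>If P did not divide B, then (A/B)^2 = -T modulo P and the pigeonhole argument would
  represent P itself. Setting T = 0 in such a representation exhibits P(0) as a square, so no
  converse of reciprocity is required.\<close>

lemma inert_prime_dvd_representation:
  fixes P A B :: "'a :: {field, finite} poly"
  assumes odd: "odd CARD('a)" and P: "P \<in> inert_primes" and dvd: "P dvd A\<^sup>2 + indet * B\<^sup>2"
  shows "P dvd A \<and> P dvd B"
proof -
  have mp: "P \<in> monic_primes" and nsq: "\<nexists>s. coeff P 0 = s\<^sup>2"
    using P by (auto simp: inert_primes_eq[OF odd])
  note pe = monic_prime_prime_elem[OF mp]
  have B: "P dvd B"
  proof (rule ccontr)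
    assume "\<not> P dvd B"
    then have inv: "P dvd B ^ (pnorm P - 1) - 1" by (rule fermat_mod_prime[OF mp])
    \<comment> \<open>By Fermat's theorem this is an inverse of B modulo P.\<close>
    define D where "D = B ^ (pnorm P - 2)"
    have "B ^ (pnorm P - 1) = B * D"
      unfolding D_def using pnorm_prime_gt_1[OF mp]
      by (metis Suc_1 Suc_diff_Suc power_Suc)
    then have BD: "P dvd B * D - 1" using inv by simp
    have "(A * D)\<^sup>2 + indet = (A\<^sup>2 + indet * B\<^sup>2) * D\<^sup>2 - (B * D - 1) * ((B * D + 1) * indet)"
      by algebra
    then have "P dvd (A * D)\<^sup>2 + indet" using dvd BD by (metis dvd_diff dvd_mult2)
    then have "representable P"
      using representable_if_minus_indet_square_mod monic_prime_degree[OF mp] monic_prime_lead_coeff[OF mp] by blast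
    then obtain X Y where "P = X\<^sup>2 + indet * Y\<^sup>2" by (auto simp: representable_def)
    then have "coeff P 0 = (coeff X 0)\<^sup>2" by (simp add: coeff_mult power2_eq_square)
    with nsq show False by blast
  qed
  then have "P dvd indet * B\<^sup>2" by (intro dvd_mult) (simp add: power2_eq_square)
  with dvd have "P dvd A\<^sup>2" by (simp add: dvd_add_left_iff)
  with B pe show ?thesis by (simp add: prime_elem_dvd_power_iff)
qed

section \<open>Multiplicities of primes and the parity criterion\<close>

definition pmult :: "'a :: {field, finite} poly \<Rightarrow> 'a poly \<Rightarrow> nat"
  where "pmult P f = (LEAST k. \<not> P ^ Suc k dvd f)"

lemma pmult_power_times:
  fixes g :: "'a :: {field, finite} poly"
  assumes P: "P \<in> monic_primes" and g: "\<not> P dvd g"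
  shows "pmult P (P ^ k * g) = k"
  unfolding pmult_def
proof (rule Least_equality)
  show "\<not> P ^ Suc k dvd P ^ k * g"
    using g monic_prime_nonzero[OF P] by (simp add: mult.commute[of P])
  show "k \<le> j" if "\<not> P ^ Suc j dvd P ^ k * g" for j
    using that by (meson dvd_mult2 le_imp_power_dvd not_less_eq_eq)
qed

text \<open>Removing factors P lowers the degree, so the process stops. At f = 0 every power of P
  divides and the least exponent in \<open>pmult\<close> does not exist.\<close>

lemma prime_power_decompose:
  fixes f :: "'a :: {field, finite} poly"
  assumes P: "P \<in> monic_primes" and f: "f \<noteq> 0"
  shows "\<exists>g. f = P ^ pmult P f * g \<and> \<not> P dvd g"
proof -
  have "\<exists>k g. f = P ^ k * g \<and> \<not> P dvd g"
    using f
  proof (induction "degree f" arbitrary: f rule: less_induct)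
    case less
    show ?case
    proof (cases "P dvd f")
      case True
      then obtain h where h: "f = P * h" by blast
      with less.prems have "h \<noteq> 0" by auto
      then have "degree h < degree f"
        using h monic_prime_degree[OF P] monic_prime_nonzero[OF P] by (simp add: degree_mult_eq)
      then obtain k g where "h = P ^ k * g" "\<not> P dvd g" using less.hyps \<open>h \<noteq> 0\<close> by blast
      then have "f = P ^ Suc k * g" "\<not> P dvd g" using h by (simp_all add: mult.assoc)
      then show ?thesis by blast
    next
      case False
      then have "f = P ^ 0 * f \<and> \<not> P dvd f" by simp
      then show ?thesis by blast
    qed
  qed
  then show ?thesis using pmult_power_times[OF P] by metis
qed

lemma pmult_prime_times_same:
  assumes "P \<in> monic_primes" "f \<noteq> 0"
  shows "pmult P (P * f) = Suc (pmult P f)"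
proof -
  obtain g where g: "f = P ^ pmult P f * g" "\<not> P dvd g" using prime_power_decompose[OF assms] by blast
  then have "P * f = P ^ Suc (pmult P f) * g" by (metis mult.assoc power_Suc)
  then show ?thesis using pmult_power_times[OF assms(1) g(2)] by metis
qed

lemma pmult_prime_times_other:
  assumes "P \<in> monic_primes" "Q \<in> monic_primes" "P \<noteq> Q" "f \<noteq> 0"
  shows "pmult P (Q * f) = pmult P f"
proof -
  obtain g where g: "f = P ^ pmult P f * g" "\<not> P dvd g" using prime_power_decompose assms by blast
  have "\<not> P dvd Q * g"
    using g assms monic_primes_dvd_imp_eq[of P Q] monic_prime_prime_elem[OF assms(1)]
    by (auto simp: prime_elem_dvd_mult_iff)
  moreover have "Q * f = P ^ pmult P f * (Q * g)" using g(1) by (metis mult.left_commute)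
  ultimately show ?thesis using pmult_power_times[OF assms(1)] by metis
qed

lemma pmult_prime_power_times_other:
  assumes "P \<in> monic_primes" "Q \<in> monic_primes" "P \<noteq> Q" "f \<noteq> 0"
  shows "pmult P (Q ^ k * f) = pmult P f"
proof (induction k)
  case (Suc k)
  have "Q ^ k * f \<noteq> 0" using assms monic_prime_nonzero by auto
  then show ?case
    using pmult_prime_times_other[OF assms(1-3), of "Q ^ k * f"] Suc by (simp add: mult.assoc)
qed simp

lemma pmult_eq_0: "\<not> P dvd f \<Longrightarrow> pmult P f = 0"
  unfolding pmult_def by (rule Least_equality) auto

text \<open>Factorization packaged as an induction: primes in \<open>X\<close> may be added singly,
  all others only in pairs. It serves with \<open>X\<close> the non-inert primes, to build
  representations, and with \<open>X\<close> = {T}, to find the support of G.\<close>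

lemma monic_prime_induct:
  fixes f :: "'a :: {field, finite} poly"
  assumes f: "lead_coeff f = 1"
    and even: "\<And>P. P \<in> monic_primes \<Longrightarrow> P \<notin> X \<Longrightarrow> even (pmult P f)"
    and one: "Q 1"
    and times: "\<And>P f. P \<in> monic_primes \<Longrightarrow> P \<in> X \<Longrightarrow> Q f \<Longrightarrow> Q (P * f)"
    and square: "\<And>P f. P \<in> monic_primes \<Longrightarrow> Q f \<Longrightarrow> Q (P\<^sup>2 * f)"
  shows "Q f"
  using f even
proof (induction "degree f" arbitrary: f rule: less_induct)
  case less
  show ?case
  proof (cases "degree f = 0")
    case True
    then show ?thesis using one less.prems monic_degree_0 by metis
  next
    case False
    then obtain P where P: "P \<in> monic_primes" "P dvd f" using exists_monic_prime_factor[of f] by blast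
    then obtain g where g: "f = P * g" by blast
    have lg: "lead_coeff g = 1"
      using monic_cofactor[of P g] monic_prime_lead_coeff[OF P(1)] less.prems(1) g by blast
    then have g0: "g \<noteq> 0" by auto
    have deg: "degree f = degree P + degree g"
      unfolding g using P lg by (intro degree_monic_mult) (auto simp: monic_prime_lead_coeff)
    have dP: "degree P > 0" using P monic_prime_degree by blast
    show ?thesis
    proof (cases "P \<in> X")
      case True
      have "even (pmult R g)" if "R \<in> monic_primes" "R \<notin> X" for R
      proof -
        have "R \<noteq> P" using that True by auto
        then have "pmult R f = pmult R g"
          unfolding g by (intro pmult_prime_times_other that P g0)
        then show ?thesis using less.prems(2)[OF that] by simp
      qed
      then have "Q g" using less.hyps[of g] deg dP lg by auto
      then show ?thesis using times[OF P(1) True] g by simp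
    next
      case False
      \<comment> \<open>The multiplicity of P in f is positive and even, so P divides the cofactor
        once more.\<close>
      have mult: "pmult P f = Suc (pmult P g)"
        unfolding g by (rule pmult_prime_times_same[OF P(1) g0])
      then have "pmult P g > 0" using less.prems(2)[OF P(1) False] by (cases "pmult P g") auto
      then have "P dvd g" using pmult_eq_0 by fastforce
      then obtain h where h: "g = P * h" by blast
      have lh: "lead_coeff h = 1"
        using monic_cofactor[of P h] monic_prime_lead_coeff[OF P(1)] lg h by blast
      then have h0: "h \<noteq> 0" by auto
      have degg: "degree g = degree P + degree h"
        unfolding h using P lh by (intro degree_monic_mult) (auto simp: monic_prime_lead_coeff)
      have "even (pmult R h)" if "R \<in> monic_primes" "R \<notin> X" for R
      proof (cases "R = P")
        case True
        then show ?thesis using mult less.prems(2)[OF P(1) False]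
          by (simp add: h pmult_prime_times_same[OF P(1) h0])
      next
        case False
        then show ?thesis using less.prems(2)[OF that] that P
          by (simp add: g h h0 pmult_prime_times_other monic_prime_nonzero)
      qed
      then have "Q h" using less.hyps[of h] deg degg dP lh by auto
      then show ?thesis using square[OF P(1)] g h by (simp add: power2_eq_square mult.assoc)
    qed
  qed
qed

text \<open>Descent: an inert prime dividing A^2 + T B^2 divides both A and B, so its square splits
  off and the quotient is again representable.\<close>

lemma representable_imp_even_multiplicity:
  fixes f :: "'a :: {field, finite} poly"
  assumes odd: "odd CARD('a)" and P: "P \<in> inert_primes" and f: "f \<noteq> 0" "representable f"
  shows "even (pmult P f)"
  using f
proof (induction "pmult P f" arbitrary: f rule: less_induct)
  case less
  have mp: "P \<in> monic_primes" using P by (simp add: inert_primes_def)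
  show ?case
  proof (cases "P dvd f")
    case True
    obtain A B where AB: "f = A\<^sup>2 + indet * B\<^sup>2" using less.prems by (auto simp: representable_def)
    then have "P dvd A \<and> P dvd B" using True inert_prime_dvd_representation[OF odd P] by blast
    then obtain C D where CD: "A = P * C" "B = P * D" by (auto elim!: dvdE)
    define g where "g = C\<^sup>2 + indet * D\<^sup>2"
    have fg: "f = P * (P * g)"
      unfolding AB CD g_def power2_eq_square by (simp only: distrib_left mult.assoc mult.left_commute)
    then have g0: "g \<noteq> 0" "P * g \<noteq> 0" using less.prems(1) by auto
    have mult: "pmult P f = Suc (Suc (pmult P g))"
      unfolding fg using pmult_prime_times_same[OF mp] g0 by simp
    have "representable g" unfolding g_def representable_def by blast
    then have "even (pmult P g)" using less.hyps[of g] mult g0 by simp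
    then show ?thesis using mult by simp
  qed (simp add: pmult_eq_0)
qed

lemma representable_iff_even_multiplicity:
  fixes f :: "'a :: {field, finite} poly"
  assumes odd: "odd CARD('a)" and f: "lead_coeff f = 1"
  shows "representable f \<longleftrightarrow> (\<forall>P\<in>inert_primes. even (pmult P f))"
proof
  assume "representable f"
  moreover have "f \<noteq> 0" using f by auto
  ultimately show "\<forall>P\<in>inert_primes. even (pmult P f)"
    using representable_imp_even_multiplicity[OF odd] by blast
next
  assume even: "\<forall>P\<in>inert_primes. even (pmult P f)"
  show "representable f"
  proof (rule monic_prime_induct[where X = "- inert_primes", OF f])
    show "representable 1" using representable_square[of 1] by simp
    show "representable (P * g)" if "P \<in> monic_primes" "P \<in> - inert_primes" "representable g" for P g :: "'a poly"
      using representable_mult[OF representable_split_prime[OF odd that(1)] that(3)] that(2) by simp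
    show "representable (P\<^sup>2 * g)" if "representable g" for P g :: "'a poly"
      using that representable_square by (rule representable_mult[rotated])
  qed (use even in auto)
qed

section \<open>Euler products of multiplicative functions\<close>

text \<open>Taking g = 1 shows that \<open>w P k\<close> is the value of \<open>W\<close> at P^k.
  Multiplicativity is phrased as splitting off the full power of a single prime, which is what an
  induction over finite sets of primes consumes.\<close>

definition prime_multiplicative :: "('a :: {field, finite} poly \<Rightarrow> real) \<Rightarrow> ('a poly \<Rightarrow> nat \<Rightarrow> real) \<Rightarrow> bool"
  where "prime_multiplicative W w \<longleftrightarrow> W 1 = 1 \<and>
    (\<forall>P\<in>monic_primes. \<forall>g k. lead_coeff g = 1 \<longrightarrow> \<not> P dvd g \<longrightarrow> W (P ^ k * g) = w P k * W g)"

definition smooth_polys :: "'a :: {field, finite} poly set \<Rightarrow> nat \<Rightarrow> 'a poly set"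
  where "smooth_polys S n = {f \<in> monic_polys n. \<forall>P\<in>monic_primes. P dvd f \<longrightarrow> P \<in> S}"

text \<open>The Euler factor at P. Writing it as a substitution u -> u^(deg P) lets identities
  between series in one variable pass to all primes at once.\<close>

definition local_fps :: "('a :: {field, finite} poly \<Rightarrow> nat \<Rightarrow> real) \<Rightarrow> 'a poly \<Rightarrow> real fps"
  where "local_fps w P = Abs_fps (w P) oo fps_X ^ degree P"

lemma local_fps_nth:
  "fps_nth (local_fps w P) n = (if degree P dvd n then w P (n div degree P) else 0)"
  by (simp add: local_fps_def fps_nth_compose_X_power)

lemma finite_smooth_polys [simp]: "finite (smooth_polys S n)"
  by (simp add: smooth_polys_def)

lemma smooth_polys_empty: "smooth_polys {} n = (if n = 0 then {1} else {})"
proof -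
  have "f = 1 \<and> n = 0" if "f \<in> smooth_polys {} n" for f :: "'a poly"
  proof -
    have "degree f = 0" using that exists_monic_prime_factor[of f] by (auto simp: smooth_polys_def)
    then show ?thesis using that monic_degree_0[of f] by (auto simp: smooth_polys_def monic_polys_def)
  qed
  moreover have "(1 :: 'a poly) \<in> smooth_polys {} 0"
    using monic_prime_irreducible by (auto simp: smooth_polys_def monic_polys_def irreducible_def)
  ultimately show ?thesis by auto
qed

lemma sum_smooth_polys_insert:
  fixes P :: "'a :: {field, finite} poly" and W :: "'a poly \<Rightarrow> real"
  assumes P: "P \<in> monic_primes" "P \<notin> S"
  shows "(\<Sum>f\<in>smooth_polys (insert P S) n. W f) =
    (\<Sum>k | k * degree P \<le> n. \<Sum>g\<in>smooth_polys S (n - k * degree P). W (P ^ k * g))"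
proof -
  let ?d = "degree P"
  note lP = monic_prime_lead_coeff[OF P(1)] and dP = monic_prime_degree[OF P(1)]
  have nd: "\<not> P dvd g" if "g \<in> smooth_polys S m" for g m
    using that P by (auto simp: smooth_polys_def)
  have lPk1: "lead_coeff (P ^ k) = 1" for k
    unfolding lead_coeff_power by (simp add: lP)
  have lPk2: "degree (P ^ k) = k * ?d" for k
    using monic_prime_nonzero[OF P(1)] by (simp add: degree_power_eq)
  note lPk = lPk1 lPk2
  have fin: "finite {k. k * ?d \<le> n}"
    by (rule finite_subset[of _ "{..n}"]) (use dP in \<open>auto intro: order_trans[rotated]\<close>)
  have "(\<Sum>f\<in>smooth_polys (insert P S) n. W f) =
      (\<Sum>(k, g)\<in>Sigma {k. k * ?d \<le> n} (\<lambda>k. smooth_polys S (n - k * ?d)). W (P ^ k * g))"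
  proof (rule sum.reindex_bij_witness[symmetric, where
      j = "\<lambda>(k, g). P ^ k * g" and i = "\<lambda>f. (pmult P f, f div P ^ pmult P f)"])
    fix x assume x: "x \<in> Sigma {k. k * ?d \<le> n} (\<lambda>k. smooth_polys S (n - k * ?d))"
    obtain k g where [simp]: "x = (k, g)" by (cases x)
    have kg: "k * ?d \<le> n" "g \<in> smooth_polys S (n - k * ?d)" using x by auto
    show "(case x of (k, g) \<Rightarrow> P ^ k * g) \<in> smooth_polys (insert P S) n"
    proof -
      have "Q \<in> insert P S" if "Q \<in> monic_primes" "Q dvd P ^ k * g" for Q
        using that kg monic_primes_dvd_imp_eq[OF that(1) P(1)] monic_prime_prime_elem[OF that(1)]
        by (auto simp: prime_elem_dvd_mult_iff smooth_polys_def dest: prime_elem_dvd_power)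
      then show ?thesis using kg lPk[of k]
        by (auto simp: smooth_polys_def monic_polys_def degree_monic_mult lead_coeff_mult)
    qed
    show "(pmult P (case x of (k, g) \<Rightarrow> P ^ k * g),
        (case x of (k, g) \<Rightarrow> P ^ k * g) div P ^ pmult P (case x of (k, g) \<Rightarrow> P ^ k * g)) = x"
      using pmult_power_times[OF P(1) nd[OF kg(2)]] monic_prime_nonzero[OF P(1)] by simp
  next
    fix f assume f: "f \<in> smooth_polys (insert P S) n"
    then have f0: "f \<noteq> 0" "lead_coeff f = 1" "degree f = n"
      by (auto simp: smooth_polys_def monic_polys_def)
    define k where "k = pmult P f"
    obtain g where g: "f = g * P ^ k" "\<not> P dvd g"
      using prime_power_decompose[OF P(1) f0(1)] by (auto simp: k_def mult.commute)
    have "f div P ^ k = g" using g monic_prime_nonzero[OF P(1)] by simp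
    have lg: "lead_coeff g = 1" using monic_cofactor[of "P ^ k" g] lPk f0 g by (simp add: mult.commute)
    have "degree f = k * ?d + degree g"
      using g degree_monic_mult[of "P ^ k" g] lPk lg by (simp add: mult.commute)
    then have deg: "k * ?d \<le> n" "degree g = n - k * ?d" using f0 by auto
    have "Q \<in> S" if "Q \<in> monic_primes" "Q dvd g" for Q
      using that f g by (auto simp: smooth_polys_def)
    then have "g \<in> smooth_polys S (n - k * ?d)" using lg deg by (auto simp: smooth_polys_def monic_polys_def)
    then show "(pmult P f, f div P ^ pmult P f) \<in>
        Sigma {k. k * ?d \<le> n} (\<lambda>k. smooth_polys S (n - k * ?d))"
      using deg \<open>f div P ^ k = g\<close> by (simp add: k_def)
    show "(case (pmult P f, f div P ^ pmult P f) of (k, g) \<Rightarrow> P ^ k * g) = f"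
      using g(1) \<open>f div P ^ k = g\<close> by (simp add: k_def mult.commute)
  qed auto
  also have "\<dots> = (\<Sum>k | k * ?d \<le> n. \<Sum>g\<in>smooth_polys S (n - k * ?d). W (P ^ k * g))"
    using fin by (subst sum.Sigma) auto
  finally show ?thesis .
qed

text \<open>Unique factorization for finitely many primes: each new prime P contributes the unique
  splitting f = P^k g with g free of P, so multiplying by its Euler factor enlarges the set of
  admissible f.\<close>

lemma euler_product_fps_nth:
  assumes W: "prime_multiplicative W w" and S: "finite S" "S \<subseteq> monic_primes"
  shows "fps_nth (\<Prod>P\<in>S. local_fps w P) n = (\<Sum>f\<in>smooth_polys S n. W f)"
  using S
proof (induction S arbitrary: n rule: finite_induct)
  case empty
  then show ?case using W by (simp add: smooth_polys_empty prime_multiplicative_def)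
next
  case (insert P S)
  let ?d = "degree P"
  have P: "P \<in> monic_primes" using insert by auto
  note dP = monic_prime_degree[OF P]
  have "fps_nth (\<Prod>P\<in>insert P S. local_fps w P) n =
      (\<Sum>i=0..n. fps_nth (local_fps w P) i * fps_nth (\<Prod>P\<in>S. local_fps w P) (n - i))"
    using insert by (simp add: fps_mult_nth)
  also have "\<dots> = (\<Sum>i\<in>(\<lambda>k. k * ?d) ` {k. k * ?d \<le> n}.
      fps_nth (local_fps w P) i * fps_nth (\<Prod>P\<in>S. local_fps w P) (n - i))"
    by (rule sum.mono_neutral_right) (auto simp: local_fps_nth mult.commute elim!: dvdE)
  also have "\<dots> = (\<Sum>k | k * ?d \<le> n. w P k * (\<Sum>g\<in>smooth_polys S (n - k * ?d). W g))"
    using dP insert by (subst sum.reindex) (auto simp: inj_on_def local_fps_nth)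
  also have "\<dots> = (\<Sum>k | k * ?d \<le> n. \<Sum>g\<in>smooth_polys S (n - k * ?d). W (P ^ k * g))"
  proof (intro sum.cong refl)
    fix k
    have "W (P ^ k * g) = w P k * W g" if "g \<in> smooth_polys S (n - k * ?d)" for g
      using W that P insert by (auto simp: prime_multiplicative_def smooth_polys_def monic_polys_def)
    then show "w P k * (\<Sum>g\<in>smooth_polys S (n - k * ?d). W g) =
        (\<Sum>g\<in>smooth_polys S (n - k * ?d). W (P ^ k * g))"
      by (simp add: sum_distrib_left)
  qed
  also have "\<dots> = (\<Sum>f\<in>smooth_polys (insert P S) n. W f)"
    using sum_smooth_polys_insert[OF P insert(2)] by simp
  finally show ?case .
qed

definition primes_upto :: "nat \<Rightarrow> 'a :: {field, finite} poly set"
  where "primes_upto N = {P \<in> monic_primes. degree P \<le> N}"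

lemma finite_primes_upto: "finite (primes_upto N)"
proof (rule finite_subset)
  show "primes_upto N \<subseteq> (\<Union>n\<le>N. monic_polys n)"
    by (auto simp: primes_upto_def monic_primes_def monic_polys_def)
qed simp

lemma smooth_polys_eq_monic:
  assumes "primes_upto n \<subseteq> S" shows "smooth_polys S n = monic_polys n"
proof -
  have "P \<in> S" if "f \<in> monic_polys n" "P \<in> monic_primes" "P dvd f" for f P
  proof -
    have "f \<noteq> 0" "degree f = n" using that by (auto simp: monic_polys_def)
    then have "degree P \<le> n" using that dvd_imp_degree_le by blast
    then show ?thesis using that assms by (auto simp: primes_upto_def)
  qed
  then show ?thesis by (auto simp: smooth_polys_def)
qed

definition monic_fps :: "('a :: {field, finite} poly \<Rightarrow> real) \<Rightarrow> real fps"
  where "monic_fps W = Abs_fps (\<lambda>n. \<Sum>f\<in>monic_polys n. W f)"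

text \<open>A monic polynomial of degree n has only prime factors of degree at most n. Each
  coefficient is therefore read off a finite product, and infinite formal products never
  occur.\<close>

lemma monic_fps_nth_eq_euler_product:
  fixes W :: "'a :: {field, finite} poly \<Rightarrow> real"
  assumes "prime_multiplicative W w" "n \<le> N"
  shows "fps_nth (monic_fps W) n = fps_nth (\<Prod>P\<in>primes_upto N. local_fps w P) n"
proof -
  have "(primes_upto n :: 'a poly set) \<subseteq> primes_upto N" using assms by (auto simp: primes_upto_def)
  then show ?thesis
    using euler_product_fps_nth[OF assms(1) finite_primes_upto[of N], of n]
      smooth_polys_eq_monic[of n "primes_upto N :: 'a poly set"]
    by (simp add: monic_fps_def) (simp add: primes_upto_def)
qed

lemma fps_mult_nth_cong:
  assumes "\<And>i. i \<le> n \<Longrightarrow> fps_nth a i = fps_nth a' i" "\<And>i. i \<le> n \<Longrightarrow> fps_nth b i = fps_nth b' i"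
    and "i \<le> n"
  shows "fps_nth (a * b) i = fps_nth (a' * b') i"
  unfolding fps_mult_nth using assms by (intro sum.cong) auto

section \<open>The generating function of the representable polynomials\<close>

text \<open>The coefficients of \<open>(1 - x) powr (-1/2)\<close>.\<close>

definition inv_sqrt_coeff :: "nat \<Rightarrow> real"
  where "inv_sqrt_coeff k = (- 1) ^ k * ((- 1 / 2) gchoose k)"

lemma inv_sqrt_coeff_0 [simp]: "inv_sqrt_coeff 0 = 1"
  by (simp add: inv_sqrt_coeff_def)

lemma inv_sqrt_coeff_Suc: "inv_sqrt_coeff (Suc k) = inv_sqrt_coeff k * ((2 * real k + 1) / (2 * real k + 2))"
proof -
  have "real (Suc k) * ((- 1 / 2) gchoose Suc k) = (- 1 / 2 - real k) * ((- 1 / 2 :: real) gchoose k)"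
    using gbinomial_mult_1[of "- 1 / 2 :: real" k] by (simp add: algebra_simps)
  then have h: "((- 1 / 2 :: real) gchoose Suc k) = (- 1 / 2 - real k) / real (Suc k) * ((- 1 / 2) gchoose k)"
    by (simp add: field_simps)
  show ?thesis unfolding inv_sqrt_coeff_def h power_Suc by (simp add: field_simps)
qed

lemma inv_sqrt_coeff_pos: "inv_sqrt_coeff k > 0"
  by (induction k) (auto simp: inv_sqrt_coeff_Suc)

lemma inv_sqrt_coeff_le_1: "inv_sqrt_coeff k \<le> 1"
proof (induction k)
  case (Suc k)
  have "inv_sqrt_coeff (Suc k) \<le> inv_sqrt_coeff k * 1"
    unfolding inv_sqrt_coeff_Suc by (intro mult_left_mono) (auto simp: less_imp_le[OF inv_sqrt_coeff_pos])
  with Suc show ?case by simp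
qed simp

text \<open>The square of (1 + x)^(-1/2) is (1 + x)^(-1), with coefficients (-1)^n; the signs built
  into \<open>inv_sqrt_coeff\<close> cancel them.\<close>

lemma sum_inv_sqrt_coeff_mult: "(\<Sum>i=0..n. inv_sqrt_coeff i * inv_sqrt_coeff (n - i)) = 1"
proof -
  have "(\<Sum>i=0..n. inv_sqrt_coeff i * inv_sqrt_coeff (n - i)) =
      (\<Sum>i=0..n. (- 1) ^ n * (((- 1 / 2) gchoose i) * ((- 1 / 2) gchoose (n - i))))"
  proof (intro sum.cong refl)
    fix i assume "i \<in> {0..n}"
    then have "(- 1 :: real) ^ n = (- 1) ^ i * (- 1) ^ (n - i)" by (simp flip: power_add)
    then show "inv_sqrt_coeff i * inv_sqrt_coeff (n - i) = (- 1) ^ n * (((- 1 / 2) gchoose i) * ((- 1 / 2) gchoose (n - i)))"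
      by (simp add: inv_sqrt_coeff_def)
  qed
  also have "\<dots> = (- 1) ^ n * fps_nth (fps_binomial (- 1 / 2) * fps_binomial (- 1 / 2)) n"
    by (simp add: fps_mult_nth sum_distrib_left)
  also have "fps_binomial (- 1 / 2 :: real) * fps_binomial (- 1 / 2) = fps_binomial (- 1)"
    using fps_binomial_add_mult[of "- 1 / 2 :: real" "- 1 / 2"] by simp
  also have "fps_nth (fps_binomial (- 1 :: real)) n = (- 1) ^ n"
    using gbinomial_minus[of "1 :: real" n] by (simp flip: binomial_gbinomial)
  finally show ?thesis by (simp flip: power_mult_distrib)
qed

lemma inv_sqrt_coeff_fps_square: "Abs_fps (\<lambda>k. inv_sqrt_coeff k * x ^ k) ^ 2 = Abs_fps (\<lambda>k. x ^ k)"
proof (rule fps_ext)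
  fix n
  have "fps_nth (Abs_fps (\<lambda>k. inv_sqrt_coeff k * x ^ k) ^ 2) n = (\<Sum>i=0..n. inv_sqrt_coeff i * inv_sqrt_coeff (n - i) * x ^ n)"
    unfolding power2_eq_square fps_mult_nth
  proof (intro sum.cong refl)
    fix i assume "i \<in> {0..n}"
    then have "x ^ n = x ^ i * x ^ (n - i)" by (simp flip: power_add)
    then show "fps_nth (Abs_fps (\<lambda>k. inv_sqrt_coeff k * x ^ k)) i * fps_nth (Abs_fps (\<lambda>k. inv_sqrt_coeff k * x ^ k)) (n - i) =
        inv_sqrt_coeff i * inv_sqrt_coeff (n - i) * x ^ n" by simp
  qed
  also have "\<dots> = x ^ n" by (simp add: sum_inv_sqrt_coeff_mult flip: sum_distrib_right)
  finally show "fps_nth (Abs_fps (\<lambda>k. inv_sqrt_coeff k * x ^ k) ^ 2) n = fps_nth (Abs_fps (\<lambda>k. x ^ k)) n" by simp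
qed

text \<open>The value is found from its square: the Cauchy product of the series with itself is the
  geometric series, and the sum is nonnegative.\<close>

lemma inv_sqrt_coeff_sums:
  assumes y: "0 \<le> y" "y < 1"
  shows "(\<lambda>k. inv_sqrt_coeff k * y ^ k) sums ((1 - y) powr (-1/2))"
proof -
  have s: "summable (\<lambda>k. inv_sqrt_coeff k * y ^ k)"
  proof (rule summable_comparison_test')
    show "summable (\<lambda>k. y ^ k)" using y by (intro summable_geometric) auto
    show "norm (inv_sqrt_coeff k * y ^ k) \<le> y ^ k" for k
      using y inv_sqrt_coeff_le_1[of k] inv_sqrt_coeff_pos[of k] mult_right_mono[of "inv_sqrt_coeff k" 1 "y ^ k"] by (simp add: abs_mult)
  qed
  have n: "summable (\<lambda>k. norm (inv_sqrt_coeff k * y ^ k))"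
    using s y inv_sqrt_coeff_pos by (simp add: abs_mult less_imp_le)
  define v where "v = (\<Sum>k. inv_sqrt_coeff k * y ^ k)"
  have v0: "v \<ge> 0" unfolding v_def using s y inv_sqrt_coeff_pos by (intro suminf_nonneg) (auto simp: less_imp_le)
  have "(\<lambda>k. \<Sum>i\<le>k. (inv_sqrt_coeff i * y ^ i) * (inv_sqrt_coeff (k - i) * y ^ (k - i))) sums (v * v)"
    unfolding v_def by (rule Cauchy_product_sums[OF n n])
  also have "(\<lambda>k. \<Sum>i\<le>k. (inv_sqrt_coeff i * y ^ i) * (inv_sqrt_coeff (k - i) * y ^ (k - i))) = (\<lambda>k. y ^ k)"
    using arg_cong[OF inv_sqrt_coeff_fps_square[of y], of fps_nth]
    by (simp add: fun_eq_iff power2_eq_square fps_mult_nth atLeast0AtMost)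
  finally have "v * v = 1 / (1 - y)" using geometric_sums[of y] y by (auto intro: sums_unique2)
  then have "v = sqrt (1 / (1 - y))" using v0 by (metis real_sqrt_mult_self real_sqrt_mult abs_of_nonneg)
  also have "\<dots> = (1 - y) powr (-1/2)"
    using y by (simp add: powr_minus powr_half_sqrt real_sqrt_divide field_simps)
  finally show ?thesis using s unfolding v_def by (metis summable_sums)
qed

text \<open>
  The coefficients of the local factors of the generating function of \<^const>\<open>bq\<close>, of the \<open>L\<close>-function of
  the character \<^const>\<open>chi\<close> of \<open>f(0)\<close>, and of a series \<open>G\<close> with
  \<open>1/G\<^sup>2 = (1 - u) \<Prod>(1 - u\<^bsup>2 deg P\<^esup>)\<close>, the product running over the inert primes.
\<close>

definition rep_weight :: "'a :: {field, finite} poly \<Rightarrow> nat \<Rightarrow> real"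
  where "rep_weight P k = (if P \<in> inert_primes \<and> odd k then 0 else 1)"

definition chi_weight :: "'a :: {field, finite} poly \<Rightarrow> nat \<Rightarrow> real"
  where "chi_weight P k = chi (coeff P 0) ^ k"

definition sqrt_weight :: "'a :: {field, finite} poly \<Rightarrow> nat \<Rightarrow> real"
  where "sqrt_weight P k =
    (if P = indet then inv_sqrt_coeff k
     else if P \<in> inert_primes then (if even k then inv_sqrt_coeff (k div 2) else 0)
     else (if k = 0 then 1 else 0))"

lemma sqrt_weight_bounds: "0 \<le> sqrt_weight P k" "sqrt_weight P k \<le> 1"
  using inv_sqrt_coeff_pos[of k] inv_sqrt_coeff_pos[of "k div 2"] inv_sqrt_coeff_le_1[of k] inv_sqrt_coeff_le_1[of "k div 2"]
  by (auto simp: sqrt_weight_def)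

lemma sqrt_weight_0: "sqrt_weight P 0 = 1"
  by (simp add: sqrt_weight_def)

lemma indet_not_inert: "odd CARD('a :: {field, finite}) \<Longrightarrow> (indet :: 'a poly) \<notin> inert_primes"
  by (auto simp: inert_primes_eq intro: exI[of _ 0])

lemma monic_prime_coeff_0:
  assumes "P \<in> monic_primes" "coeff P 0 = 0" shows "P = indet"
proof -
  have "indet dvd P" using assms(2) by (simp add: indet_dvd_iff poly_0_coeff_0)
  then show ?thesis using monic_primes_dvd_imp_eq[OF indet_monic_prime assms(1)] by simp
qed

lemma chi_inert: "odd CARD('a) \<Longrightarrow> P \<in> inert_primes \<Longrightarrow> chi (coeff P 0) = -1"
  for P :: "'a :: {field, finite} poly"
  by (auto simp: inert_primes_eq chi_def intro: exI[of _ 0])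

lemma chi_split:
  fixes P :: "'a :: {field, finite} poly"
  assumes "odd CARD('a)" "P \<in> monic_primes" "P \<notin> inert_primes" "P \<noteq> indet"
  shows "chi (coeff P 0) = 1"
  using assms monic_prime_coeff_0[of P] by (auto simp: inert_primes_eq chi_def)

text \<open>With v for u^(deg P), both sides are (1 - v)^(-2) at T, where the character vanishes. At
  an inert prime they are (1 - v^2)^(-2), because (1 - v)(1 + v) = 1 - v^2. At every other prime the
  character is 1, G has factor 1, and both sides are (1 - v)^(-2).\<close>

lemma local_weight_identity:
  fixes P :: "'a :: {field, finite} poly"
  assumes odd: "odd CARD('a)" and P: "P \<in> monic_primes"
  shows "Abs_fps (rep_weight P) ^ 2 =
    Abs_fps (\<lambda>_. 1) * Abs_fps (chi_weight P) * Abs_fps (sqrt_weight P) ^ 2"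
proof -
  have delta: "Abs_fps (\<lambda>k. if k = 0 then 1 else 0) = (1 :: real fps)"
    by (rule fps_ext) simp
  have cb2: "Abs_fps inv_sqrt_coeff ^ 2 = Abs_fps (\<lambda>_. 1)" using inv_sqrt_coeff_fps_square[of 1] by simp
  consider "P = indet" | "P \<in> inert_primes" | "P \<noteq> indet" "P \<notin> inert_primes" by blast
  then show ?thesis
  proof cases
    case 1
    have "chi_weight P = (\<lambda>k. if k = 0 then 1 else 0)"
      using 1 by (auto simp: chi_weight_def chi_def power_0_left)
    moreover have "rep_weight P = (\<lambda>_. 1)" "sqrt_weight P = inv_sqrt_coeff"
      using 1 indet_not_inert[OF odd] by (auto simp: rep_weight_def sqrt_weight_def)
    ultimately show ?thesis by (simp only: delta cb2 mult_1_right) (simp add: power2_eq_square)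
  next
    case 2
    define E :: "real fps" where "E = Abs_fps (\<lambda>k. if even k then 1 else 0)"
    have "rep_weight P = (\<lambda>k. if even k then 1 else 0)"
      using 2 by (auto simp: rep_weight_def)
    then have r: "Abs_fps (rep_weight P) = E" by (simp add: E_def)
    have "P \<noteq> indet" using 2 indet_not_inert[OF odd] by auto
    then have "Abs_fps (sqrt_weight P) = Abs_fps inv_sqrt_coeff oo fps_X ^ 2"
      using 2 by (intro fps_ext) (auto simp: sqrt_weight_def fps_nth_compose_X_power)
    then have "Abs_fps (sqrt_weight P) ^ 2 = (Abs_fps inv_sqrt_coeff ^ 2) oo fps_X ^ 2"
      by (simp add: power2_eq_square fps_compose_mult_distrib)
    also have "\<dots> = E" unfolding cb2
      by (intro fps_ext) (auto simp: E_def fps_nth_compose_X_power)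
    finally have s: "Abs_fps (sqrt_weight P) ^ 2 = E" .
    have "Abs_fps (\<lambda>_. 1) * Abs_fps (chi_weight P) = E"
    proof (rule fps_ext)
      fix n
      have "(\<Sum>i=0..n. (- 1 :: real) ^ i) = (if even n then 1 else 0)" by (induction n) auto
      then show "fps_nth (Abs_fps (\<lambda>_. 1) * Abs_fps (chi_weight P)) n = fps_nth E n"
        by (subst mult.commute) (simp add: fps_mult_nth chi_weight_def chi_inert[OF odd 2] E_def)
    qed
    with r s show ?thesis by (simp add: power2_eq_square)
  next
    case 3
    have "sqrt_weight P = (\<lambda>k. if k = 0 then 1 else 0)" "rep_weight P = (\<lambda>_. 1)" "chi_weight P = (\<lambda>_. 1)"
      using 3 chi_split[OF odd P] by (auto simp: sqrt_weight_def rep_weight_def chi_weight_def)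
    then show ?thesis by (simp add: delta power2_eq_square)
  qed
qed

lemma local_fps_identity:
  fixes P :: "'a :: {field, finite} poly"
  assumes odd: "odd CARD('a)" and P: "P \<in> monic_primes"
  shows "local_fps rep_weight P * local_fps rep_weight P =
    local_fps (\<lambda>_ _. 1) P * local_fps chi_weight P * (local_fps sqrt_weight P * local_fps sqrt_weight P)"
  using arg_cong[OF local_weight_identity[OF odd P], of "\<lambda>F. F oo fps_X ^ degree P"]
    monic_prime_degree[OF P]
  by (simp add: local_fps_def power2_eq_square fps_compose_mult_distrib)

lemma prime_multiplicative_one: "prime_multiplicative (\<lambda>_. 1) (\<lambda>_ _. 1)"
  by (simp add: prime_multiplicative_def)

lemma prime_multiplicative_chi:
  assumes odd: "odd CARD('a :: {field, finite})"
  shows "prime_multiplicative (\<lambda>f :: 'a poly. chi (coeff f 0)) chi_weight"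
proof -
  have "chi (1 :: 'a) = 1" by (auto simp: chi_def intro: exI[of _ 1])
  moreover have "chi (coeff (P ^ k * g) 0) = chi (coeff P 0) ^ k * chi (coeff g 0)" for P g :: "'a poly" and k
    by (induction k) (simp_all add: mult.assoc chi_mult[OF odd] coeff_mult_0)
  ultimately show ?thesis by (simp add: prime_multiplicative_def chi_weight_def)
qed

lemma bq_eq: "bq f = (if representable f then 1 else 0)"
  by (simp add: bq_def representable_def)

lemma prime_multiplicative_bq:
  assumes odd: "odd CARD('a :: {field, finite})"
  shows "prime_multiplicative (\<lambda>f :: 'a poly. real (bq f)) rep_weight"
proof -
  have "representable (P ^ k * g) \<longleftrightarrow> (P \<in> inert_primes \<longrightarrow> even k) \<and> representable g"
    if P: "P \<in> monic_primes" and g: "lead_coeff g = 1" "\<not> P dvd g" for P g :: "'a poly" and k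
  proof -
    have g0: "g \<noteq> 0" using g by auto
    have l: "lead_coeff (P ^ k * g) = 1"
      unfolding lead_coeff_mult lead_coeff_power using g monic_prime_lead_coeff[OF P] by simp
    have "pmult Q (P ^ k * g) = pmult Q g" if "Q \<in> inert_primes" "Q \<noteq> P" for Q
      using that P g0 by (intro pmult_prime_power_times_other) (auto simp: inert_primes_def)
    moreover have "pmult P (P ^ k * g) = k" "pmult P g = 0"
      using pmult_power_times[OF P g(2)] pmult_eq_0[OF g(2)] by auto
    ultimately show ?thesis
      unfolding representable_iff_even_multiplicity[OF odd l] representable_iff_even_multiplicity[OF odd g(1)]
      by (metis even_zero)
  qed
  moreover have "representable (1 :: 'a poly)" using representable_square[of 1] by simp
  ultimately show ?thesis by (simp add: prime_multiplicative_def bq_eq rep_weight_def)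
qed

text \<open>The other three series start from known functions of f. For G only local factors are
  given, so its function of f is assembled from them.\<close>

definition prod_weight :: "('a :: {field, finite} poly \<Rightarrow> nat \<Rightarrow> real) \<Rightarrow> 'a poly \<Rightarrow> real"
  where "prod_weight w f = (\<Prod>P\<in>{P \<in> monic_primes. P dvd f}. w P (pmult P f))"

lemma finite_monic_prime_divisors:
  assumes "f \<noteq> 0" shows "finite {P \<in> monic_primes. P dvd f}"
proof (rule finite_subset[OF _ finite_primes_upto])
  show "{P \<in> monic_primes. P dvd f} \<subseteq> primes_upto (degree f)"
    using dvd_imp_degree_le assms by (auto simp: primes_upto_def)
qed

lemma prime_multiplicative_prod_weight:
  fixes w :: "'a :: {field, finite} poly \<Rightarrow> nat \<Rightarrow> real"
  assumes w: "\<And>P. w P 0 = 1"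
  shows "prime_multiplicative (prod_weight w) w"
proof -
  have "{P \<in> monic_primes. P dvd (1 :: 'a poly)} = {}"
    using monic_prime_irreducible by (auto simp: irreducible_def)
  then have "prod_weight w 1 = 1" by (simp only: prod_weight_def prod.empty)
  moreover have "prod_weight w (P ^ k * g) = w P k * prod_weight w g"
    if P: "P \<in> monic_primes" and g: "lead_coeff g = 1" "\<not> P dvd g" for P g :: "'a poly" and k
  proof -
    have g0: "g \<noteq> 0" using g by auto
    let ?A = "{Q \<in> monic_primes. Q dvd g}"
    have fin: "finite ?A" by (rule finite_monic_prime_divisors[OF g0])
    have "prod_weight w (P ^ k * g) = (\<Prod>Q\<in>insert P ?A. w Q (pmult Q (P ^ k * g)))"
      unfolding prod_weight_def
    proof (rule prod.mono_neutral_left)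
      show "{Q \<in> monic_primes. Q dvd P ^ k * g} \<subseteq> insert P ?A"
      proof
        fix Q assume "Q \<in> {Q \<in> monic_primes. Q dvd P ^ k * g}"
        then have Q: "Q \<in> monic_primes" "Q dvd P ^ k \<or> Q dvd g"
          by (auto simp: prime_elem_dvd_mult_iff monic_prime_prime_elem)
        then have "Q dvd P \<or> Q dvd g"
          using prime_elem_dvd_power[OF monic_prime_prime_elem] by blast
        then show "Q \<in> insert P ?A" using Q monic_primes_dvd_imp_eq[OF Q(1) P] by auto
      qed
      show "\<forall>Q\<in>insert P ?A - {Q \<in> monic_primes. Q dvd P ^ k * g}. w Q (pmult Q (P ^ k * g)) = 1"
      proof
        fix Q assume "Q \<in> insert P ?A - {Q \<in> monic_primes. Q dvd P ^ k * g}"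
        then have "\<not> Q dvd P ^ k * g" using P by blast
        then show "w Q (pmult Q (P ^ k * g)) = 1" by (simp add: pmult_eq_0 w)
      qed
    qed (use fin in auto)
    also have "\<dots> = w P (pmult P (P ^ k * g)) * (\<Prod>Q\<in>?A. w Q (pmult Q (P ^ k * g)))"
      using fin g by simp
    also have "pmult P (P ^ k * g) = k" by (rule pmult_power_times[OF P g(2)])
    also have "(\<Prod>Q\<in>?A. w Q (pmult Q (P ^ k * g))) = prod_weight w g"
      unfolding prod_weight_def
    proof (rule prod.cong[OF refl])
      fix Q assume Q: "Q \<in> ?A"
      then have "pmult Q (P ^ k * g) = pmult Q g"
        using g by (intro pmult_prime_power_times_other P g0) auto
      then show "w Q (pmult Q (P ^ k * g)) = w Q (pmult Q g)" by simp
    qed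
    finally show ?thesis .
  qed
  ultimately show ?thesis by (simp add: prime_multiplicative_def)
qed

abbreviation sqrt_prod :: "'a :: {field, finite} poly \<Rightarrow> real"
  where "sqrt_prod \<equiv> prod_weight sqrt_weight"

lemma prime_multiplicative_sqrt_prod: "prime_multiplicative sqrt_prod sqrt_weight"
  by (rule prime_multiplicative_prod_weight) (rule sqrt_weight_0)

lemma sqrt_prod_bounds: "0 \<le> sqrt_prod f" "sqrt_prod f \<le> 1"
  by (auto simp: prod_weight_def sqrt_weight_bounds intro!: prod_nonneg prod_le_1)

section \<open>Closed forms of the global series and extraction of the square root\<close>

lemma monic_fps_one: "monic_fps (\<lambda>_ :: 'a :: {field, finite} poly. 1) = Abs_fps (\<lambda>n. real CARD('a) ^ n)"
  by (simp add: monic_fps_def card_monic_polys)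

lemma monic_polys_Suc: "monic_polys (Suc n) = (\<lambda>(a, p). pCons a p) ` (UNIV \<times> monic_polys n)"
proof (intro equalityI subsetI)
  fix f :: "'a poly" assume f: "f \<in> monic_polys (Suc n)"
  obtain a p where ap: "f = pCons a p" by (cases f)
  with f have "p \<noteq> 0" by (auto simp: monic_polys_def)
  with f ap have "p \<in> monic_polys n" by (auto simp: monic_polys_def)
  with ap show "f \<in> (\<lambda>(a, p). pCons a p) ` (UNIV \<times> monic_polys n)" by auto
qed (auto simp: monic_polys_def)

lemma monic_polys_0: "monic_polys 0 = {1}"
  using monic_degree_0 by (auto simp: monic_polys_def)

text \<open>For n > 0 the constant coefficient of a monic polynomial of degree n ranges freely over
  F_q, independently of the others, and the character sums to zero over F_q.\<close>

lemma monic_fps_chi: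
  assumes odd: "odd CARD('a :: {field, finite})"
  shows "monic_fps (\<lambda>f :: 'a poly. chi (coeff f 0)) = 1"
proof (rule fps_ext)
  fix n
  show "fps_nth (monic_fps (\<lambda>f :: 'a poly. chi (coeff f 0))) n = fps_nth 1 n"
  proof (cases n)
    case 0
    then show ?thesis by (auto simp: monic_fps_def monic_polys_0 chi_def intro: exI[of _ 1])
  next
    case (Suc m)
    have "inj_on (\<lambda>(a, p). pCons a p) (UNIV \<times> monic_polys m :: ('a \<times> 'a poly) set)"
      by (auto simp: inj_on_def)
    then have "(\<Sum>f\<in>monic_polys (Suc m). chi (coeff f 0 :: 'a)) =
        (\<Sum>(a, p)\<in>UNIV \<times> (monic_polys m :: 'a poly set). chi (a :: 'a))"
      by (simp add: monic_polys_Suc sum.reindex) (simp add: case_prod_beta)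
    also have "\<dots> = 0"
      using sum_chi[OF odd] by (simp flip: sum.cartesian_product sum_distrib_left)
    finally show ?thesis using Suc by (simp add: monic_fps_def)
  qed
qed

lemma monic_fps_bq_square:
  assumes odd: "odd CARD('a :: {field, finite})"
  shows "monic_fps (\<lambda>f :: 'a poly. real (bq f)) ^ 2 =
    (Abs_fps (\<lambda>k. inv_sqrt_coeff k * real CARD('a) ^ k) * monic_fps (sqrt_prod :: 'a poly \<Rightarrow> real)) ^ 2"
proof -
  let ?D = "monic_fps (\<lambda>f :: 'a poly. real (bq f))"
  let ?Z = "monic_fps (\<lambda>_ :: 'a poly. 1)"
  let ?L = "monic_fps (\<lambda>f :: 'a poly. chi (coeff f 0))"
  let ?G = "monic_fps (sqrt_prod :: 'a poly \<Rightarrow> real)"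
  have "?D * ?D = ?Z * ?L * (?G * ?G)"
  proof (rule fps_ext)
    fix n
    let ?E = "\<lambda>w. \<Prod>P\<in>(primes_upto n :: 'a poly set). local_fps w P"
    note eq = prime_multiplicative_bq[OF odd, THEN monic_fps_nth_eq_euler_product]
      prime_multiplicative_one[THEN monic_fps_nth_eq_euler_product]
      prime_multiplicative_chi[OF odd, THEN monic_fps_nth_eq_euler_product]
      prime_multiplicative_sqrt_prod[THEN monic_fps_nth_eq_euler_product]
    have "fps_nth (?D * ?D) n = fps_nth (?E rep_weight * ?E rep_weight) n"
      by (rule fps_mult_nth_cong[of n]) (auto intro: eq)
    also have "?E rep_weight * ?E rep_weight =
        ?E (\<lambda>_ _. 1) * ?E chi_weight * (?E sqrt_weight * ?E sqrt_weight)"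
      unfolding prod.distrib[symmetric]
      by (intro prod.cong refl local_fps_identity odd) (auto simp: primes_upto_def)
    also have "fps_nth \<dots> n = fps_nth (?Z * ?L * (?G * ?G)) n"
      by (rule sym, intro fps_mult_nth_cong[of n]) (auto intro: eq)
    finally show "fps_nth (?D * ?D) n = fps_nth (?Z * ?L * (?G * ?G)) n" .
  qed
  then show ?thesis
    by (simp add: monic_fps_one monic_fps_chi[OF odd] power_mult_distrib inv_sqrt_coeff_fps_square power2_eq_square[of ?D]
        power2_eq_square[of ?G])
qed

text \<open>In an integral domain equal squares determine a series up to sign, and both series have
  constant term 1.\<close>

lemma monic_fps_bq:
  assumes odd: "odd CARD('a :: {field, finite})"
  shows "monic_fps (\<lambda>f :: 'a poly. real (bq f)) =
    Abs_fps (\<lambda>k. inv_sqrt_coeff k * real CARD('a) ^ k) * monic_fps (sqrt_prod :: 'a poly \<Rightarrow> real)"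
    (is "?D = ?C * ?G")
proof -
  have "?D = ?C * ?G \<or> ?D = - (?C * ?G)"
    using monic_fps_bq_square[OF odd] by (simp only: power2_eq_iff)
  moreover have "?D \<noteq> - (?C * ?G)"
  proof
    assume "?D = - (?C * ?G)"
    then have "fps_nth ?D 0 = - fps_nth (?C * ?G) 0" by (metis fps_neg_nth)
    then show False
      using prime_multiplicative_bq[OF odd] prime_multiplicative_sqrt_prod[where ?'a = 'a]
      by (simp add: monic_fps_def monic_polys_0 prime_multiplicative_def)
  qed
  ultimately show ?thesis by blast
qed

lemma Bq_eq_convolution:
  assumes odd: "odd CARD('a :: {field, finite})"
  shows "real (Bq TYPE('a) n) / real CARD('a) ^ n =
    (\<Sum>j\<le>n. inv_sqrt_coeff (n - j) * (fps_nth (monic_fps (sqrt_prod :: 'a poly \<Rightarrow> real)) j / real CARD('a) ^ j))"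
proof -
  let ?g = "fps_nth (monic_fps (sqrt_prod :: 'a poly \<Rightarrow> real))" and ?q = "real CARD('a)"
  have q: "?q > 0" using card_field_gt_1[where ?'a = 'a] by simp
  have "real (Bq TYPE('a) n) = fps_nth (monic_fps (\<lambda>f :: 'a poly. real (bq f))) n"
    by (simp add: Bq_def monic_fps_def)
  also have "\<dots> = (\<Sum>j=0..n. ?g j * (inv_sqrt_coeff (n - j) * ?q ^ (n - j)))"
    unfolding monic_fps_bq[OF odd] by (subst mult.commute) (simp add: fps_mult_nth)
  also have "\<dots> = (\<Sum>j\<le>n. inv_sqrt_coeff (n - j) * (?g j / ?q ^ j)) * ?q ^ n"
    unfolding sum_distrib_right atLeast0AtMost
  proof (intro sum.cong refl)
    fix j assume "j \<in> {..n}"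
    then have "?q ^ n = ?q ^ j * ?q ^ (n - j)" by (simp flip: power_add)
    then show "?g j * (inv_sqrt_coeff (n - j) * ?q ^ (n - j)) = inv_sqrt_coeff (n - j) * (?g j / ?q ^ j) * ?q ^ n"
      using q by simp
  qed
  finally show ?thesis using q by simp
qed

text \<open>Apart from T, a prime with odd exponent has weight 0: inert primes by the shape of their
  factor, the others because their factor is 1.\<close>

lemma sqrt_prod_support:
  fixes f :: "'a :: {field, finite} poly"
  assumes f: "lead_coeff f = 1" and nz: "sqrt_prod f \<noteq> 0"
  shows "\<exists>e b. f = indet ^ e * b\<^sup>2 \<and> lead_coeff b = 1"
proof (rule monic_prime_induct[where X = "{indet}", OF f])
  fix P :: "'a poly" assume P: "P \<in> monic_primes" "P \<notin> {indet}"
  have f0: "f \<noteq> 0" using f by auto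
  show "even (pmult P f)"
  proof (cases "P dvd f")
    case True
    then have "sqrt_weight P (pmult P f) \<noteq> 0"
      using nz P finite_monic_prime_divisors[OF f0] by (auto simp: prod_weight_def)
    then show ?thesis using P by (auto simp: sqrt_weight_def split: if_splits)
  qed (simp add: pmult_eq_0)
next
  show "\<exists>e b. (1 :: 'a poly) = indet ^ e * b\<^sup>2 \<and> lead_coeff b = 1"
    by (intro exI[of _ 0] exI[of _ 1]) simp
next
  fix P g :: "'a poly"
  assume "P \<in> {indet}" "\<exists>e b. g = indet ^ e * b\<^sup>2 \<and> lead_coeff b = 1"
  then obtain e b where "P * g = indet ^ Suc e * b\<^sup>2" "lead_coeff b = 1"
    by (auto simp: mult.assoc)
  then show "\<exists>e b. P * g = indet ^ e * b\<^sup>2 \<and> lead_coeff b = 1" by blast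
next
  fix P g :: "'a poly"
  assume P: "P \<in> monic_primes" and "\<exists>e b. g = indet ^ e * b\<^sup>2 \<and> lead_coeff b = 1"
  then obtain e b where eb: "g = indet ^ e * b\<^sup>2" "lead_coeff b = 1" by blast
  have "P\<^sup>2 * g = indet ^ e * (P * b)\<^sup>2"
    unfolding eb(1) power_mult_distrib by (simp only: mult.left_commute)
  moreover have "lead_coeff (P * b) = 1"
    unfolding lead_coeff_mult using eb(2) monic_prime_lead_coeff[OF P] by simp
  ultimately show "\<exists>e b. P\<^sup>2 * g = indet ^ e * b\<^sup>2 \<and> lead_coeff b = 1" by blast
qed

text \<open>G is supported on T^e b^2 with values at most 1. There are n + 1 choices of e, and e
  fixes the degree of b, leaving at most q^(n/2) choices of b.\<close>

lemma monic_fps_sqrt_prod_le: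
  "fps_nth (monic_fps (sqrt_prod :: 'a :: {field, finite} poly \<Rightarrow> real)) n \<le>
    real (n + 1) * sqrt (real CARD('a)) ^ n"
proof -
  let ?q = "real CARD('a)"
  have q: "?q \<ge> 1" using card_field_gt_1[where ?'a = 'a] by simp
  let ?F = "{f \<in> monic_polys n. sqrt_prod f \<noteq> 0} :: 'a poly set"
  let ?V = "\<lambda>e. (\<lambda>b. indet ^ e * b\<^sup>2) ` (monic_polys ((n - e) div 2) :: 'a poly set)"
  have sub: "?F \<subseteq> (\<Union>e\<le>n. ?V e)"
  proof
    fix f assume f: "f \<in> ?F"
    then obtain e b where eb: "f = indet ^ e * b\<^sup>2" "lead_coeff b = 1"
      using sqrt_prod_support[of f] by (auto simp: monic_polys_def)
    have "b \<noteq> 0" using eb(2) by auto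
    then have "n = e + 2 * degree b"
      using f eb(1) by (simp add: monic_polys_def degree_mult_eq degree_power_eq)
    then have "e \<le> n" "b \<in> monic_polys ((n - e) div 2)" using eb(2) by (auto simp: monic_polys_def)
    then show "f \<in> (\<Union>e\<le>n. ?V e)" using eb(1) by blast
  qed
  have "fps_nth (monic_fps (sqrt_prod :: 'a poly \<Rightarrow> real)) n = (\<Sum>f\<in>?F. sqrt_prod f)"
    unfolding monic_fps_def fps_nth_Abs_fps by (rule sum.mono_neutral_right) auto
  also have "\<dots> \<le> (\<Sum>f\<in>?F. 1)" by (intro sum_mono sqrt_prod_bounds)
  also have "\<dots> = real (card ?F)" by simp
  also have "card ?F \<le> card (\<Union>e\<le>n. ?V e)" using sub by (intro card_mono) auto
  also have "\<dots> \<le> (\<Sum>e\<le>n. card (?V e))" by (rule card_UN_le) simp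
  also have "\<dots> \<le> (\<Sum>e\<le>n. CARD('a) ^ ((n - e) div 2))"
    by (intro sum_mono order_trans[OF card_image_le]) (auto simp: card_monic_polys)
  finally have "fps_nth (monic_fps (sqrt_prod :: 'a poly \<Rightarrow> real)) n \<le>
      (\<Sum>e\<le>n. ?q ^ ((n - e) div 2))" by simp
  also have "\<dots> \<le> (\<Sum>e\<le>n. sqrt ?q ^ n)"
  proof (intro sum_mono)
    fix e
    have "?q ^ ((n - e) div 2) = sqrt ?q ^ (2 * ((n - e) div 2))"
      using q by (simp add: power_mult)
    also have "\<dots> \<le> sqrt ?q ^ n" using q by (intro power_increasing) auto
    finally show "?q ^ ((n - e) div 2) \<le> sqrt ?q ^ n" .
  qed
  finally show ?thesis by simp
qed

section \<open>The Euler product at 1/q\<close>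

lemma fps_sums_mult:
  fixes F G :: "real fps"
  assumes "\<And>n. fps_nth F n \<ge> 0" "\<And>n. fps_nth G n \<ge> 0" "x \<ge> 0"
    and F: "(\<lambda>n. fps_nth F n * x ^ n) sums a" and G: "(\<lambda>n. fps_nth G n * x ^ n) sums b"
  shows "(\<lambda>n. fps_nth (F * G) n * x ^ n) sums (a * b)"
proof -
  have "(\<lambda>n. \<Sum>i\<le>n. (fps_nth F i * x ^ i) * (fps_nth G (n - i) * x ^ (n - i))) sums
      ((\<Sum>n. fps_nth F n * x ^ n) * (\<Sum>n. fps_nth G n * x ^ n))"
    using assms by (intro Cauchy_product_sums) (auto simp: sums_iff)
  moreover have "(\<Sum>i\<le>n. (fps_nth F i * x ^ i) * (fps_nth G (n - i) * x ^ (n - i))) =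
      fps_nth (F * G) n * x ^ n" for n
    unfolding fps_mult_nth sum_distrib_right atLeast0AtMost
  proof (intro sum.cong refl)
    fix i assume "i \<in> {..n}"
    then have "x ^ n = x ^ i * x ^ (n - i)" by (simp flip: power_add)
    then show "(fps_nth F i * x ^ i) * (fps_nth G (n - i) * x ^ (n - i)) =
        fps_nth F i * fps_nth G (n - i) * x ^ n" by simp
  qed
  ultimately show ?thesis using F G by (simp add: sums_iff)
qed

lemma fps_sums_prod:
  fixes F :: "'b \<Rightarrow> real fps"
  assumes "finite S" "x \<ge> 0" "\<And>P n. P \<in> S \<Longrightarrow> fps_nth (F P) n \<ge> 0"
    "\<And>P. P \<in> S \<Longrightarrow> (\<lambda>n. fps_nth (F P) n * x ^ n) sums v P"
  shows "(\<forall>n. fps_nth (\<Prod>P\<in>S. F P) n \<ge> 0) \<and> (\<lambda>n. fps_nth (\<Prod>P\<in>S. F P) n * x ^ n) sums (\<Prod>P\<in>S. v P)"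
  using assms
proof (induction S rule: finite_induct)
  case empty
  then show ?case using sums_single[of 0 "\<lambda>_. 1 :: real"] by (auto simp: if_distrib[of "\<lambda>y. y * _"] cong: if_cong)
next
  case (insert P S)
  then have IH: "\<And>n. fps_nth (\<Prod>P\<in>S. F P) n \<ge> 0" "(\<lambda>n. fps_nth (\<Prod>P\<in>S. F P) n * x ^ n) sums (\<Prod>P\<in>S. v P)"
    by auto
  have "fps_nth (F P * (\<Prod>P\<in>S. F P)) n \<ge> 0" for n
    unfolding fps_mult_nth using insert IH by (intro sum_nonneg mult_nonneg_nonneg) auto
  moreover have "(\<lambda>n. fps_nth (F P * (\<Prod>P\<in>S. F P)) n * x ^ n) sums (v P * (\<Prod>P\<in>S. v P))"
    using insert IH by (intro fps_sums_mult) auto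
  ultimately show ?case using insert by simp
qed

text \<open>The case m = 1 is the factor at T and m = 2 the factor at an inert prime; only exponents
  that are multiples of m deg P occur.\<close>

lemma local_fps_sums:
  assumes P: "degree P > 0" and m: "m > 0" and x: "0 \<le> x" "x < 1"
    and w: "\<And>k. w P k = (if m dvd k then inv_sqrt_coeff (k div m) else 0)"
  shows "(\<lambda>n. fps_nth (local_fps w P) n * x ^ n) sums ((1 - x ^ (m * degree P)) powr (-1/2))"
proof -
  let ?f = "\<lambda>n. fps_nth (local_fps w P) n * x ^ n"
  let ?g = "\<lambda>k. k * (m * degree P)"
  have "?f (?g k) = inv_sqrt_coeff k * (x ^ (m * degree P)) ^ k" for k
  proof -
    have "?g k = k * m * degree P" by simp
    then have "fps_nth (local_fps w P) (?g k) = inv_sqrt_coeff k"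
      unfolding local_fps_nth w using P m by simp
    moreover have "x ^ ?g k = (x ^ (m * degree P)) ^ k" by (metis mult.commute power_mult)
    ultimately show ?thesis by simp
  qed
  moreover have "x ^ (m * degree P) < 1" using x m P by (intro power_less_one_iff[THEN iffD2]) auto
  then have "(\<lambda>k. inv_sqrt_coeff k * (x ^ (m * degree P)) ^ k) sums ((1 - x ^ (m * degree P)) powr (-1/2))"
    using x by (intro inv_sqrt_coeff_sums) auto
  ultimately have "(\<lambda>k. ?f (?g k)) sums ((1 - x ^ (m * degree P)) powr (-1/2))" by simp
  moreover have "strict_mono ?g" using P m by (auto simp: strict_mono_def)
  moreover have "?f n = 0" if "n \<notin> range ?g" for n
  proof (rule ccontr)
    assume "?f n \<noteq> 0"
    then have "degree P dvd n" "m dvd n div degree P" by (auto simp: local_fps_nth w split: if_splits)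
    then obtain j k where "n = degree P * j" "n div degree P = m * k" by (metis dvdE)
    then have "n = ?g k" using P by simp
    then show False using that by blast
  qed
  ultimately show ?thesis using sums_mono_reindex[of ?g ?f] by blast
qed

lemma sqrt_euler_product_sums:
  fixes S :: "'a :: {field, finite} poly set"
  assumes odd: "odd CARD('a)" and S: "finite S" "S \<subseteq> inert_primes"
  shows "(\<lambda>n. fps_nth (\<Prod>P\<in>insert indet S. local_fps sqrt_weight P) n * (1 / real CARD('a)) ^ n) sums
    ((1 - 1 / real CARD('a)) powr (-1/2) * (\<Prod>P\<in>S. euler_factor P))"
proof -
  let ?x = "1 / real CARD('a)"
  have x: "0 \<le> ?x" "?x < 1" using card_field_gt_1[where ?'a = 'a] by auto
  let ?v = "\<lambda>P :: 'a poly. if P = indet then (1 - ?x) powr (-1/2) else euler_factor P"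
  have nS: "indet \<notin> S" using S indet_not_inert[OF odd] by auto
  have "(\<lambda>n. fps_nth (local_fps sqrt_weight P) n * ?x ^ n) sums ?v P" if "P \<in> insert indet S" for P
  proof (cases "P = indet")
    case True
    then show ?thesis using local_fps_sums[of indet 1 ?x sqrt_weight] x by (simp add: sqrt_weight_def)
  next
    case False
    then have P: "P \<in> inert_primes" using that S by auto
    have "P \<in> monic_primes" using P by (simp add: inert_primes_def)
    note d = monic_prime_degree[OF this]
    have "euler_factor P = (1 - ?x ^ (2 * degree P)) powr (-1/2)"
      by (simp add: euler_factor_def pnorm_def power_divide power_mult[symmetric] mult.commute)
    then show ?thesis
      using local_fps_sums[of P 2 ?x sqrt_weight] x d P False by (simp add: sqrt_weight_def)
  qed
  then have "(\<lambda>n. fps_nth (\<Prod>P\<in>insert indet S. local_fps sqrt_weight P) n * ?x ^ n) sums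
      (\<Prod>P\<in>insert indet S. ?v P)"
    using fps_sums_prod[of "insert indet S" ?x "local_fps sqrt_weight" ?v] S(1) x
    by (auto simp: local_fps_nth sqrt_weight_bounds)
  also have "(\<Prod>P\<in>insert indet S. ?v P) = (1 - ?x) powr (-1/2) * (\<Prod>P\<in>S. euler_factor P)"
    using S(1) nS by (auto intro!: prod.cong)
  finally show ?thesis .
qed

lemma sqrt_euler_product_nth_le:
  fixes S :: "'a :: {field, finite} poly set"
  assumes S: "finite S" "S \<subseteq> monic_primes"
  shows "fps_nth (\<Prod>P\<in>S. local_fps sqrt_weight P) n \<le> fps_nth (monic_fps (sqrt_prod :: 'a poly \<Rightarrow> real)) n"
  unfolding euler_product_fps_nth[OF prime_multiplicative_sqrt_prod S] monic_fps_def fps_nth_Abs_fps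
  by (rule sum_mono2) (auto simp: smooth_polys_def sqrt_prod_bounds)

text \<open>Primes that are neither T nor inert have factor 1 in G and may be added to the product
  freely.\<close>

lemma sqrt_euler_product_nth_eq:
  fixes S :: "'a :: {field, finite} poly set"
  assumes S: "finite S" "S \<subseteq> monic_primes" "indet \<in> S" "inert_primes \<inter> primes_upto n \<subseteq> S"
  shows "fps_nth (\<Prod>P\<in>S. local_fps sqrt_weight P) n = fps_nth (monic_fps (sqrt_prod :: 'a poly \<Rightarrow> real)) n"
proof -
  let ?S = "S \<union> primes_upto n"
  have fin: "finite ?S" "?S \<subseteq> monic_primes"
    using S finite_primes_upto by (auto simp: primes_upto_def)
  have "local_fps sqrt_weight P = 1" if "P \<in> ?S - S" for P
  proof -
    have "P \<noteq> indet" "P \<notin> inert_primes" "P \<in> monic_primes" using that S(3,4) by (auto simp: primes_upto_def)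
    then show ?thesis using monic_prime_degree[of P]
      by (intro fps_ext) (auto simp: local_fps_nth sqrt_weight_def elim!: dvdE)
  qed
  then have "(\<Prod>P\<in>S. local_fps sqrt_weight P) = (\<Prod>P\<in>?S. local_fps sqrt_weight P)"
    using fin by (intro prod.mono_neutral_left) auto
  then show ?thesis
    using smooth_polys_eq_monic[of n ?S]
    by (simp add: euler_product_fps_nth[OF prime_multiplicative_sqrt_prod fin] monic_fps_def)
qed

lemma summable_sqrt_prod:
  assumes odd: "odd CARD('a :: {field, finite})"
  shows "summable (\<lambda>n. fps_nth (monic_fps (sqrt_prod :: 'a poly \<Rightarrow> real)) n / real CARD('a) ^ n *
    (real n + 1) ^ 2)"
proof (rule summable_comparison_test')
  \<comment> \<open>An odd q is at least 3, and (5/3)^2 < 3 gives 1/sqrt q at most 3/5. The cube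
    joins the square of the statement to the factor n + 1 in the bound for G; 4/5 is any ratio
    between 3/5 and 1.\<close>
  show "summable (\<lambda>n. (real n + 1) ^ 3 * (3 / 5) ^ n)"
  proof (rule summable_comparison_test_bigo)
    show "summable (\<lambda>n. norm ((4 / 5 :: real) ^ n))" by (simp add: summable_geometric)
    show "(\<lambda>n. (real n + 1) ^ 3 * (3 / 5) ^ n) \<in> O(\<lambda>n. (4 / 5) ^ n)" by real_asymp
  qed
next
  fix n :: nat
  let ?q = "real CARD('a)" and ?g = "fps_nth (monic_fps (sqrt_prod :: 'a poly \<Rightarrow> real)) n"
  have "CARD('a) \<ge> 3" using odd card_field_gt_1[where ?'a = 'a] by presburger
  then have q: "?q \<ge> 3" by simp
  have "5 / 3 \<le> sqrt ?q" using q by (intro real_le_rsqrt) (simp add: power2_eq_square)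
  have "?g \<ge> 0" by (auto simp: monic_fps_def sqrt_prod_bounds intro: sum_nonneg)
  have "?g / ?q ^ n \<le> real (n + 1) * sqrt ?q ^ n / ?q ^ n"
    using q by (intro divide_right_mono monic_fps_sqrt_prod_le) auto
  also have "\<dots> = real (n + 1) * (1 / sqrt ?q) ^ n"
  proof -
    have "?q = sqrt ?q * sqrt ?q" by simp
    then have "?q ^ n = sqrt ?q ^ n * sqrt ?q ^ n" by (metis power_mult_distrib)
    then show ?thesis using q by (simp add: power_divide field_simps)
  qed
  also have "\<dots> \<le> real (n + 1) * (3 / 5) ^ n"
    using \<open>5 / 3 \<le> sqrt ?q\<close> q by (intro mult_left_mono power_mono) (auto simp: field_simps)
  finally have "?g / ?q ^ n * (real n + 1) ^ 2 \<le> real (n + 1) * (3 / 5) ^ n * (real n + 1) ^ 2"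
    by (rule mult_right_mono) simp
  also have "\<dots> = (real n + 1) ^ 3 * (3 / 5) ^ n" by (simp add: power3_eq_cube power2_eq_square)
  finally show "norm (?g / ?q ^ n * (real n + 1) ^ 2) \<le> (real n + 1) ^ 3 * (3 / 5) ^ n"
    using \<open>?g \<ge> 0\<close> by simp
qed

text \<open>A sandwich. All coefficients are nonnegative, so a finite product is at most A; once it
  contains the inert primes of degree at most N, its coefficients below N are those of G, and it is
  at least the partial sum up to N.\<close>

lemma euler_product_tendsto:
  assumes odd: "odd CARD('a :: {field, finite})"
    and A: "(\<lambda>n. fps_nth (monic_fps (sqrt_prod :: 'a poly \<Rightarrow> real)) n / real CARD('a) ^ n) sums A"
  shows "((\<lambda>S. (1 - 1 / real CARD('a)) powr (-1/2) * (\<Prod>P\<in>S. euler_factor P)) \<longlongrightarrow> A)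
    (finite_subsets_at_top (inert_primes :: 'a poly set))"
proof (rule tendstoI)
  fix e :: real assume e: "e > 0"
  let ?g = "fps_nth (monic_fps (sqrt_prod :: 'a poly \<Rightarrow> real))" and ?q = "real CARD('a)"
  let ?H = "\<lambda>S :: 'a poly set. \<Prod>P\<in>insert indet S. local_fps sqrt_weight P"
  have q: "?q > 0" using card_field_gt_1[where ?'a = 'a] by simp
  have g0: "?g n \<ge> 0" for n by (auto simp: monic_fps_def sqrt_prod_bounds intro: sum_nonneg)
  obtain N where N: "dist (\<Sum>n<N. ?g n / ?q ^ n) A < e"
    using A e unfolding sums_def by (meson LIMSEQ_iff_nz metric_LIMSEQ_D order_refl)
  define X where "X = (inert_primes \<inter> primes_upto N :: 'a poly set)"
  show "\<forall>\<^sub>F S in finite_subsets_at_top (inert_primes :: 'a poly set).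
      dist ((1 - 1 / ?q) powr (-1/2) * (\<Prod>P\<in>S. euler_factor P)) A < e"
    unfolding eventually_finite_subsets_at_top
  proof (intro exI[of _ X] conjI allI impI)
    show "finite X" "X \<subseteq> inert_primes" using finite_primes_upto by (auto simp: X_def)
    fix S :: "'a poly set" assume S: "finite S \<and> X \<subseteq> S \<and> S \<subseteq> inert_primes"
    define V where "V = (1 - 1 / ?q) powr (-1/2) * (\<Prod>P\<in>S. euler_factor P)"
    have V: "(\<lambda>n. fps_nth (?H S) n * (1 / ?q) ^ n) sums V"
      unfolding V_def using S by (intro sqrt_euler_product_sums[OF odd]) auto
    have SM: "finite (insert indet S)" "insert indet S \<subseteq> monic_primes"
      using S by (auto simp: inert_primes_def)
    have le: "fps_nth (?H S) n * (1 / ?q) ^ n \<le> ?g n / ?q ^ n" for n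
      using mult_right_mono[OF sqrt_euler_product_nth_le[OF SM, of n], of "(1 / ?q) ^ n"] q
      by (simp add: power_divide)
    have nonneg: "0 \<le> fps_nth (?H S) n * (1 / ?q) ^ n" for n
      unfolding euler_product_fps_nth[OF prime_multiplicative_sqrt_prod SM]
      using q by (auto intro!: sum_nonneg mult_nonneg_nonneg sqrt_prod_bounds divide_nonneg_nonneg)
    have "V \<le> A" using sums_le[OF le V A] .
    have "(\<Sum>n<N. ?g n / ?q ^ n) = (\<Sum>n<N. fps_nth (?H S) n * (1 / ?q) ^ n)"
    proof (intro sum.cong refl)
      fix n assume "n \<in> {..<N}"
      then have "primes_upto n \<subseteq> (primes_upto N :: 'a poly set)" by (auto simp: primes_upto_def)
      then have "inert_primes \<inter> primes_upto n \<subseteq> insert indet S" using S X_def by auto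
      then have "fps_nth (?H S) n = ?g n" by (intro sqrt_euler_product_nth_eq SM) auto
      then show "?g n / ?q ^ n = fps_nth (?H S) n * (1 / ?q) ^ n" by (simp add: power_divide)
    qed
    also have "\<dots> \<le> V" using V nonneg by (auto simp: sums_iff intro!: sum_le_suminf)
    finally have "dist V A < e" using N \<open>V \<le> A\<close> by (simp add: dist_real_def)
    then show "dist ((1 - 1 / ?q) powr (-1/2) * (\<Prod>P\<in>S. euler_factor P)) A < e"
      by (simp only: V_def)
  qed
qed

section \<open>Asymptotics of the convolution\<close>

lemma wallis_inv_sqrt_coeff:
  "(\<Prod>k=1..n. (4 * real k ^ 2) / (4 * real k ^ 2 - 1)) = 1 / ((2 * real n + 1) * inv_sqrt_coeff n ^ 2)"
proof (induction n)
  case (Suc n)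
  have eq: "4 * real (Suc n) ^ 2 - 1 = (2 * real n + 1) * (2 * real n + 3)"
    by (simp add: power2_eq_square algebra_simps)
  have cbS: "inv_sqrt_coeff (Suc n) ^ 2 = inv_sqrt_coeff n ^ 2 * ((2 * real n + 1) ^ 2 / (4 * real (Suc n) ^ 2))"
    by (simp add: inv_sqrt_coeff_Suc power_mult_distrib power_divide power2_eq_square algebra_simps)
  have "(\<Prod>k=1..Suc n. (4 * real k ^ 2) / (4 * real k ^ 2 - 1)) =
      1 / ((2 * real n + 1) * inv_sqrt_coeff n ^ 2) * (4 * real (Suc n) ^ 2 / ((2 * real n + 1) * (2 * real n + 3)))"
    using Suc eq by simp
  also have "\<dots> = 1 / ((2 * real (Suc n) + 1) * inv_sqrt_coeff (Suc n) ^ 2)"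
    unfolding cbS using inv_sqrt_coeff_pos[of n] by (simp add: power2_eq_square divide_simps add_eq_0_iff)
  finally show ?case .
qed simp

lemma inv_sqrt_coeff_square_tendsto: "(\<lambda>n. (real n + 1 / 2) * inv_sqrt_coeff n ^ 2) \<longlonglongrightarrow> 1 / pi"
proof -
  have "(\<lambda>n. inverse (1 / ((2 * real n + 1) * inv_sqrt_coeff n ^ 2)) * (1 / 2)) \<longlonglongrightarrow> inverse (pi / 2) * (1 / 2)"
    using wallis unfolding wallis_inv_sqrt_coeff by (intro tendsto_mult tendsto_inverse tendsto_const) auto
  then show ?thesis by (simp add: algebra_simps)
qed

text \<open>This sequence decreases to its limit, since (2n + 1)(2n + 3) < (2n + 2)^2. With n in
  place of n + 1/2 it increases, which gives the matching upper bound; the pair yields an explicit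
  rate beyond the bare limit from Wallis.\<close>

lemma inv_sqrt_coeff_square_lower: "1 / pi \<le> (real n + 1 / 2) * inv_sqrt_coeff n ^ 2"
proof (rule decseq_ge[OF _ inv_sqrt_coeff_square_tendsto])
  show "decseq (\<lambda>n. (real n + 1 / 2) * inv_sqrt_coeff n ^ 2)"
  proof (rule decseq_SucI)
    fix n
    have "(real (Suc n) + 1 / 2) * inv_sqrt_coeff (Suc n) ^ 2 =
        inv_sqrt_coeff n ^ 2 * ((real n + 3 / 2) * ((2 * real n + 1) / (2 * real n + 2)) ^ 2)"
    proof -
      have "real (Suc n) + 1 / 2 = real n + 3 / 2" by simp
      then show ?thesis by (simp only: inv_sqrt_coeff_Suc power_mult_distrib ac_simps)
    qed
    also have "\<dots> \<le> inv_sqrt_coeff n ^ 2 * (real n + 1 / 2)"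
    proof (rule mult_left_mono)
      show "(real n + 3 / 2) * ((2 * real n + 1) / (2 * real n + 2)) ^ 2 \<le> real n + 1 / 2"
        by (simp add: power_divide divide_simps) (simp add: power2_eq_square algebra_simps)
    qed simp
    finally show "(real (Suc n) + 1 / 2) * inv_sqrt_coeff (Suc n) ^ 2 \<le> (real n + 1 / 2) * inv_sqrt_coeff n ^ 2"
      by (simp add: mult.commute)
  qed
qed

lemma inv_sqrt_coeff_square_upper: "real n * inv_sqrt_coeff n ^ 2 \<le> 1 / pi"
proof (rule incseq_le[of "\<lambda>n. real n * inv_sqrt_coeff n ^ 2"])
  show "incseq (\<lambda>n. real n * inv_sqrt_coeff n ^ 2)"
  proof (rule incseq_SucI)
    fix n
    have "inv_sqrt_coeff n ^ 2 * real n \<le> inv_sqrt_coeff n ^ 2 * (real (Suc n) * ((2 * real n + 1) / (2 * real n + 2)) ^ 2)"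
    proof (rule mult_left_mono)
      show "real n \<le> real (Suc n) * ((2 * real n + 1) / (2 * real n + 2)) ^ 2"
        by (simp add: power_divide divide_simps) (simp add: power2_eq_square algebra_simps)
    qed simp
    then show "real n * inv_sqrt_coeff n ^ 2 \<le> real (Suc n) * inv_sqrt_coeff (Suc n) ^ 2"
      by (simp only: inv_sqrt_coeff_Suc power_mult_distrib ac_simps)
  qed
  have "(\<lambda>n. (real n + 1 / 2) * inv_sqrt_coeff n ^ 2 * (real n / (real n + 1 / 2))) \<longlonglongrightarrow> 1 / pi * 1"
    by (intro tendsto_mult inv_sqrt_coeff_square_tendsto) real_asymp
  moreover have "(real n + 1 / 2) * inv_sqrt_coeff n ^ 2 * (real n / (real n + 1 / 2)) = real n * inv_sqrt_coeff n ^ 2" for n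
    by (simp add: field_simps)
  ultimately show "(\<lambda>n. real n * inv_sqrt_coeff n ^ 2) \<longlonglongrightarrow> 1 / pi" by (simp add: mult.commute)
qed

lemma inv_sqrt_coeff_lower: "1 / sqrt (pi * (real n + 1 / 2)) \<le> inv_sqrt_coeff n"
proof -
  have "1 / (pi * (real n + 1 / 2)) \<le> inv_sqrt_coeff n ^ 2"
    using inv_sqrt_coeff_square_lower[of n] by (simp only: divide_divide_eq_left[symmetric]) (subst pos_divide_le_eq; simp add: mult.commute)
  then have "sqrt (1 / (pi * (real n + 1 / 2))) \<le> inv_sqrt_coeff n"
    using inv_sqrt_coeff_pos[of n] by (intro real_le_lsqrt) auto
  then show ?thesis by (simp add: real_sqrt_divide)
qed

lemma inv_sqrt_coeff_upper:
  assumes "n > 0" shows "inv_sqrt_coeff n \<le> 1 / sqrt (pi * real n)"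
proof -
  have "inv_sqrt_coeff n ^ 2 \<le> 1 / (pi * real n)"
    using inv_sqrt_coeff_square_upper[of n] assms by (simp add: field_simps)
  then have "inv_sqrt_coeff n \<le> sqrt (1 / (pi * real n))" by (intro real_le_rsqrt)
  then show ?thesis by (simp add: real_sqrt_divide)
qed

lemma inverse_sqrt_diff_le:
  fixes a b :: real
  assumes "0 < a" "a \<le> b"
  shows "1 / sqrt (pi * a) - 1 / sqrt (pi * b) \<le> (b - a) / (a * sqrt b)"
proof -
  have s: "sqrt a > 0" "sqrt b > 0" "sqrt a \<le> sqrt b" using assms by auto
  have "b - a = (sqrt b - sqrt a) * (sqrt b + sqrt a)"
    using assms by (simp add: algebra_simps)
  have "1 / sqrt (pi * a) - 1 / sqrt (pi * b) = (1 / sqrt a - 1 / sqrt b) / sqrt pi"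
    by (simp add: real_sqrt_mult field_simps)
  also have "\<dots> \<le> (1 / sqrt a - 1 / sqrt b) / 1"
    using s pi_ge_two by (intro divide_left_mono) (auto simp: field_simps)
  also have "\<dots> = (sqrt b - sqrt a) * sqrt a / (a * sqrt b)"
    using s assms by (simp add: field_simps)
  also have "\<dots> \<le> (sqrt b - sqrt a) * (sqrt b + sqrt a) / (a * sqrt b)"
    using s assms by (intro divide_right_mono mult_left_mono) auto
  also have "\<dots> = (b - a) / (a * sqrt b)" using \<open>b - a = _\<close> by simp
  finally show ?thesis .
qed

text \<open>One bound for all j, extended by zero beyond n, so that it can be summed against the
  coefficients of G. For 2j < n the index n - j exceeds n/2 and two inverse roots are compared; for
  larger j the right side is at least 1 and the claim is trivial.\<close>

lemma inv_sqrt_coeff_shift_bound: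
  assumes n: "n > 0"
  shows "\<bar>(if j \<le> n then inv_sqrt_coeff (n - j) else 0) - 1 / sqrt (pi * real n)\<bar> \<le>
    4 * (real j + 1) ^ 2 / (real n * sqrt (real n))"
proof (cases "2 * j < n")
  case True
  define m where "m = n - j"
  have m: "m > 0" "m \<le> n" "real n \<le> 2 * real m" "real m = real n - real j" using True n by (auto simp: m_def)
  have B: "4 * (real j + 1) ^ 2 \<ge> 2 * real j + 1"
    by (simp add: power2_eq_square algebra_simps)
  have "inv_sqrt_coeff m - 1 / sqrt (pi * real n) \<le> 1 / sqrt (pi * real m) - 1 / sqrt (pi * real n)"
    using inv_sqrt_coeff_upper[OF m(1)] by simp
  also have "\<dots> \<le> (real n - real m) / (real m * sqrt (real n))"
    using m by (intro inverse_sqrt_diff_le) auto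
  also have "\<dots> \<le> (real n - real m) / (real n / 2 * sqrt (real n))"
    using m n by (intro divide_left_mono mult_right_mono) auto
  also have "\<dots> = 2 * real j / (real n * sqrt (real n))" using m by simp
  also have "\<dots> \<le> 4 * (real j + 1) ^ 2 / (real n * sqrt (real n))"
    using B by (intro divide_right_mono) auto
  finally have up: "inv_sqrt_coeff m - 1 / sqrt (pi * real n) \<le> 4 * (real j + 1) ^ 2 / (real n * sqrt (real n))" .
  \<comment> \<open>From below no shift by j is felt, as m is at most n; only the offset 1/2 in the
    lower bound costs an error.\<close>
  have "1 / sqrt (pi * (real n + 1 / 2)) \<le> 1 / sqrt (pi * (real m + 1 / 2))"
    using m by (intro divide_left_mono) auto
  also have "\<dots> \<le> inv_sqrt_coeff m" by (rule inv_sqrt_coeff_lower)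
  finally have "1 / sqrt (pi * real n) - inv_sqrt_coeff m \<le> 1 / sqrt (pi * real n) - 1 / sqrt (pi * (real n + 1 / 2))"
    by simp
  also have "\<dots> \<le> (real n + 1 / 2 - real n) / (real n * sqrt (real n + 1 / 2))"
    using n by (intro inverse_sqrt_diff_le) auto
  also have "\<dots> \<le> 1 / (real n * sqrt (real n))"
    using n by (intro frac_le mult_left_mono) auto
  also have "\<dots> \<le> 4 * (real j + 1) ^ 2 / (real n * sqrt (real n))"
    using B by (intro divide_right_mono) auto
  finally show ?thesis using up True by (simp add: m_def abs_le_iff)
next
  case False
  have "1 / sqrt (pi * real n) \<le> 1"
  proof -
    have "1 \<le> pi * real n" using n pi_ge_two mult_mono[of 1 pi 1 "real n"] by simp
    then show ?thesis by simp
  qed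
  moreover have "1 / sqrt (pi * real n) \<ge> 0" by simp
  moreover have "0 \<le> (if j \<le> n then inv_sqrt_coeff (n - j) else 0)" "(if j \<le> n then inv_sqrt_coeff (n - j) else 0) \<le> 1"
    using inv_sqrt_coeff_pos[of "n - j"] inv_sqrt_coeff_le_1[of "n - j"] by auto
  ultimately have "\<bar>(if j \<le> n then inv_sqrt_coeff (n - j) else 0) - 1 / sqrt (pi * real n)\<bar> \<le> 1" by linarith
  \<comment> \<open>Here 2(j + 1) is at least n, so 4(j + 1)^2 is at least n^2. This accounts for
    the constant 4 and for the quadratic weight in the summability requirement.\<close>
  also have "1 \<le> 4 * (real j + 1) ^ 2 / (real n * sqrt (real n))"
  proof -
    have "sqrt (real n) \<le> real n" using n by (intro real_le_lsqrt) (auto simp: power2_eq_square)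
    then have "real n * sqrt (real n) \<le> real n * real n" by (intro mult_left_mono) auto
    also have "\<dots> \<le> (2 * (real j + 1)) * (2 * (real j + 1))" using False by (intro mult_mono) auto
    finally show ?thesis using n by (simp add: power2_eq_square field_simps)
  qed
  finally show ?thesis .
qed

lemma convolution_inv_sqrt_coeff_bound:
  fixes a :: "nat \<Rightarrow> real"
  assumes a: "\<And>j. a j \<ge> 0" and s: "summable (\<lambda>j. a j * (real j + 1) ^ 2)" and A: "a sums A" and n: "n > 0"
  shows "\<bar>(\<Sum>j\<le>n. inv_sqrt_coeff (n - j) * a j) - A / sqrt (pi * real n)\<bar> \<le>
    4 * (\<Sum>j. a j * (real j + 1) ^ 2) / (real n * sqrt (real n))"
proof -
  let ?c = "\<lambda>j. if j \<le> n then inv_sqrt_coeff (n - j) else 0" and ?K = "1 / sqrt (pi * real n)"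
  let ?b = "\<lambda>j. 4 / (real n * sqrt (real n)) * (a j * (real j + 1) ^ 2)"
  have "(\<lambda>j. ?c j * a j) sums (\<Sum>j\<le>n. ?c j * a j)"
    by (rule sums_finite) auto
  also have "(\<Sum>j\<le>n. ?c j * a j) = (\<Sum>j\<le>n. inv_sqrt_coeff (n - j) * a j)" by simp
  finally have "(\<lambda>j. ?c j * a j - ?K * a j) sums ((\<Sum>j\<le>n. inv_sqrt_coeff (n - j) * a j) - ?K * A)"
    using A by (intro sums_diff sums_mult)
  then have sm: "(\<lambda>j. (?c j - ?K) * a j) sums ((\<Sum>j\<le>n. inv_sqrt_coeff (n - j) * a j) - ?K * A)"
    by (simp only: left_diff_distrib)
  have le: "norm ((?c j - ?K) * a j) \<le> ?b j" for j
  proof -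
    have "norm ((?c j - ?K) * a j) = \<bar>?c j - ?K\<bar> * a j" using a by (simp only: real_norm_def abs_mult abs_of_nonneg)
    also have "\<dots> \<le> (4 * (real j + 1) ^ 2 / (real n * sqrt (real n))) * a j"
      using a by (intro mult_right_mono inv_sqrt_coeff_shift_bound n)
    also have "\<dots> = ?b j" by (simp only: times_divide_eq_left times_divide_eq_right mult.commute mult.left_commute)
    finally show ?thesis .
  qed
  have sb: "summable ?b" using s by (rule summable_mult)
  have sn: "summable (\<lambda>j. norm ((?c j - ?K) * a j))"
    by (rule summable_comparison_test'[OF sb]) (use le in simp)
  have "norm (\<Sum>j. (?c j - ?K) * a j) \<le> (\<Sum>j. norm ((?c j - ?K) * a j))"
    by (rule summable_norm[OF sn])
  also have "\<dots> \<le> (\<Sum>j. ?b j)" by (rule suminf_le[OF le sn sb])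
  also have "\<dots> = 4 / (real n * sqrt (real n)) * (\<Sum>j. a j * (real j + 1) ^ 2)"
    using s by (rule suminf_mult)
  finally show ?thesis using sums_unique[OF sm] by simp
qed

theorem theorem1p3:
  fixes q :: nat
  assumes "CARD('a :: {field, finite}) = q" and "odd q"
  shows "euler_product_converges TYPE('a) \<and>
    (\<lambda>n. real (Bq TYPE('a) n) - Kq TYPE('a) / sqrt pi * (real q ^ n / sqrt (real n)))
      \<in> O(\<lambda>n. real q ^ n / real n powr (3/2))"
proof -
  have odd: "odd CARD('a)" using assms by simp
  have q: "real q > 1" using card_field_gt_1[where ?'a = 'a] assms by simp
  let ?F = "finite_subsets_at_top (inert_primes :: 'a poly set)"
  define a where "a n = fps_nth (monic_fps (sqrt_prod :: 'a poly \<Rightarrow> real)) n / real q ^ n" for n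
  have a0: "a n \<ge> 0" for n
    using q by (auto simp: a_def monic_fps_def sqrt_prod_bounds intro!: divide_nonneg_nonneg sum_nonneg)
  have s2: "summable (\<lambda>n. a n * (real n + 1) ^ 2)"
    using summable_sqrt_prod[OF odd] assms by (simp add: a_def)
  have "summable a"
  proof (rule summable_comparison_test'[OF s2])
    show "norm (a n) \<le> a n * (real n + 1) ^ 2" for n
      using mult_left_mono[of 1 "(real n + 1) ^ 2" "a n"] a0[of n] by simp
  qed
  then obtain A where A: "a sums A" by (auto simp: summable_def)
  define u where "u = (1 - 1 / real q) powr (-1/2)"
  have u: "u > 0" using q by (simp add: u_def)
  have lim: "((\<lambda>S. u * (\<Prod>P\<in>S. euler_factor P)) \<longlongrightarrow> A) ?F"
    using euler_product_tendsto[OF odd] A assms by (simp add: a_def[abs_def] u_def)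
  \<comment> \<open>Dividing by the positive factor of T isolates the product over inert primes;
    this gives its convergence and also identifies A, the value of G at 1/q, with
    \<open>Kq\<close>.\<close>
  then have "((\<lambda>S. u * (\<Prod>P\<in>S. euler_factor P) / u) \<longlongrightarrow> A / u) ?F"
    using u by (intro tendsto_divide tendsto_const) auto
  then have lim': "((\<lambda>S. \<Prod>P\<in>S. euler_factor P) \<longlongrightarrow> A / u) ?F" using u by simp
  then have "Lim ?F (\<lambda>S. \<Prod>P\<in>S. euler_factor P) = A / u"
    by (intro tendsto_Lim) (simp_all add: finite_subsets_at_top_neq_bot)
  then have K: "Kq TYPE('a) = A" using u assms by (simp add: Kq_def u_def)
  have "(\<lambda>n. real (Bq TYPE('a) n) - A / sqrt pi * (real q ^ n / sqrt (real n)))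
      \<in> O(\<lambda>n. real q ^ n / real n powr (3/2))"
  proof (rule bigoI)
    show "\<forall>\<^sub>F n in at_top. norm (real (Bq TYPE('a) n) - A / sqrt pi * (real q ^ n / sqrt (real n))) \<le>
        4 * (\<Sum>j. a j * (real j + 1) ^ 2) * norm (real q ^ n / real n powr (3/2))"
      using eventually_gt_at_top[of 0]
    proof eventually_elim
      case (elim n)
      have B: "real (Bq TYPE('a) n) = (\<Sum>j\<le>n. inv_sqrt_coeff (n - j) * a j) * real q ^ n"
        using Bq_eq_convolution[OF odd, of n] q assms by (simp add: a_def field_simps)
      have pw: "real n powr (3/2) = real n * sqrt (real n)"
        using elim powr_add[of "real n" 1 "1/2"] by (simp add: powr_half_sqrt)
      have "real (Bq TYPE('a) n) - A / sqrt pi * (real q ^ n / sqrt (real n)) =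
          ((\<Sum>j\<le>n. inv_sqrt_coeff (n - j) * a j) - A / sqrt (pi * real n)) * real q ^ n"
        by (simp add: B real_sqrt_mult algebra_simps)
      then have "norm (real (Bq TYPE('a) n) - A / sqrt pi * (real q ^ n / sqrt (real n))) =
          \<bar>(\<Sum>j\<le>n. inv_sqrt_coeff (n - j) * a j) - A / sqrt (pi * real n)\<bar> * real q ^ n"
        using q by (simp add: abs_mult)
      also have "\<dots> \<le> 4 * (\<Sum>j. a j * (real j + 1) ^ 2) / (real n * sqrt (real n)) * real q ^ n"
        using q elim by (intro mult_right_mono convolution_inv_sqrt_coeff_bound a0 s2 A) auto
      finally show ?case using q by (simp add: pw)
    qed
  qed
  then show ?thesis
    unfolding euler_product_converges_def K using lim' by blast
qed

end
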